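(* Let $(M,g)$ be a smooth Riemannian manifold of dimension $n$, let $p\le n$, let $\omega=\sum_{i=0}^{p}g^i\omega_{p-i}$ (with $\omega_{p-i}\in E^{p-i,p-i}$) be a double form of order $p$, decomposed following the orthogonal splitting $D^{p,p}=E^{p,p}\oplus gE^{p-1,p-1}\oplus\dots\oplus g^pE^{0,0}$, and let $1\le k<p$. Then $c^k\omega$ is proportional to $g^{p-k}$ if and only if $$\omega_r=0\quad\text{for } 1\le r\le p-k.$$
   Context: $D^{p,p}=\Lambda^{*p}M\otimes\Lambda^{*p}M$ denotes the bundle of double forms of degree (order) $p$, where $\Lambda^{*p}M$ is the bundle of differential $p$-forms; its sections are also called double forms. $D^{0,0}$ is the trivial line bundle (functions). The product of double forms is the exterior (Kulkarni-Nomizu) product $(\theta_1\otimes\theta_2)(\theta_3\otimes\theta_4)=(\theta_1\wedge\theta_3)\otimes(\theta_2\wedge\theta_4)$, and powers $g^i$ of the metric $g\in D^{1,1}$ are taken with respect to it. The Ricci contraction $c:D^{p,p}\to D^{p-1,p-1}$ is $c\omega(x_2,\dots,x_p;y_2,\dots,y_p)=\sum_{j=1}^n\omega(e_j,x_2,\dots,x_p;e_j,y_2,\dots,y_p)$ for an orthonormal basis $(e_j)$ of the tangent space, with $c=0$ on $D^{0,0}$; $c^k$ is its $k$-th iterate. $E^{r,r}=\ker c\subset D^{r,r}$ is the bundle of trace free double forms of order $r$. For $1\le p\le n$ one has the orthogonal decomposition $D^{p,p}=E^{p,p}\oplus gE^{p-1,p-1}\oplus\dots\oplus g^pE^{0,0}$.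 In this decomposition, "$\omega_r=0$" means that the component $g^{p-r}\omega_r$ of $\omega$ in the summand $g^{p-r}E^{r,r}$ vanishes. "Proportional to $g^{p-k}$" means $c^k\omega=\lambda g^{p-k}$ for some function $\lambda$ on $M$. *)

theory Defs
  imports "HOL-Analysis.Analysis" "HOL-Library.Function_Algebras"
begin

section \<open>Functions as a real vector space\<close>

instantiation "fun" :: (type, real_vector) real_vector
begin

definition scaleR_fun :: "real \<Rightarrow> ('a \<Rightarrow> 'b) \<Rightarrow> 'a \<Rightarrow> 'b" where
  "scaleR_fun a f = (\<lambda>x. a *\<^sub>R f x)"

instance
  by standard (simp_all add: scaleR_fun_def fun_eq_iff algebra_simps)

end


section \<open>Double forms on a vector space\<close>

text \<open>
  Throughout, a vector space is a subspace \<open>T\<close> of a type \<open>'v\<close>, and a tuple of vectors is a list.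
  A form is extended by \<open>0\<close> to the lists that have the wrong length or that contain a vector
  outside \<open>T\<close>, so that two forms on \<open>T\<close> are equal if and only if they are equal as functions.
\<close>

type_synonym 'v form = "'v list \<Rightarrow> real"
type_synonym 'v dform = "'v list \<Rightarrow> 'v list \<Rightarrow> real"

definition alternating_forms :: "nat \<Rightarrow> 'v::real_vector set \<Rightarrow> 'v form set" where
  "alternating_forms p T = {\<alpha>.
     (\<forall>xs. \<not> (length xs = p \<and> set xs \<subseteq> T) \<longrightarrow> \<alpha> xs = 0) \<and>
     (\<forall>xs i u v a b. length xs = p \<and> set xs \<subseteq> T \<and> i < p \<and> u \<in> T \<and> v \<in> T \<longrightarrow>
        \<alpha> (xs[i := a *\<^sub>R u + b *\<^sub>R v]) = a * \<alpha> (xs[i := u]) + b * \<alpha> (xs[i := v])) \<and>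
     (\<forall>xs i j. length xs = p \<and> set xs \<subseteq> T \<and> i < j \<and> j < p \<and> xs ! i = xs ! j \<longrightarrow> \<alpha> xs = 0)}"

text \<open>
  For finite-dimensional \<open>T\<close>, the space \<open>\<Lambda>\<^sup>p T\<^sup>* \<otimes> \<Lambda>\<^sup>p T\<^sup>*\<close> is identified with the functions of two
  blocks of \<open>p\<close> vectors that are alternating and multilinear in each block;
  \<open>\<theta>\<^sub>1 \<otimes> \<theta>\<^sub>2\<close> corresponds to \<open>\<lambda>xs ys. \<theta>\<^sub>1 xs * \<theta>\<^sub>2 ys\<close>.
\<close>

definition dform_space :: "nat \<Rightarrow> 'v::real_vector set \<Rightarrow> 'v dform set" where
  "dform_space p T = {\<omega>. (\<forall>ys. (\<lambda>xs. \<omega> xs ys) \<in> alternating_forms p T) \<and>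
                         (\<forall>xs. (\<lambda>ys. \<omega> xs ys) \<in> alternating_forms p T)}"

definition wedge :: "nat \<Rightarrow> nat \<Rightarrow> 'v form \<Rightarrow> 'v form \<Rightarrow> 'v form" where
  "wedge p q \<alpha> \<beta> xs = (if length xs = p + q then
     (\<Sum>\<sigma> | \<sigma> permutes {..<p + q}. of_int (sign \<sigma>) *
        (\<alpha> (map (\<lambda>i. xs ! \<sigma> i) [0..<p]) * \<beta> (map (\<lambda>i. xs ! \<sigma> i) [p..<p + q])))
     / (fact p * fact q) else 0)"

text \<open>
  The exterior product of a double form of order \<open>p\<close> with one of order \<open>q\<close>: the bilinear extension
  of \<open>(\<theta>\<^sub>1 \<otimes> \<theta>\<^sub>2) (\<theta>\<^sub>3 \<otimes> \<theta>\<^sub>4) = (\<theta>\<^sub>1 \<and> \<theta>\<^sub>3) \<otimes> (\<theta>\<^sub>2 \<and> \<theta>\<^sub>4)\<close>, see lemma \<open>dform_prod_tensor\<close>.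
\<close>

definition dform_prod :: "nat \<Rightarrow> nat \<Rightarrow> 'v dform \<Rightarrow> 'v dform \<Rightarrow> 'v dform" where
  "dform_prod p q \<omega> \<eta> xs ys = (if length xs = p + q \<and> length ys = p + q then
     (\<Sum>\<sigma> | \<sigma> permutes {..<p + q}. \<Sum>\<tau> | \<tau> permutes {..<p + q}. of_int (sign \<sigma> * sign \<tau>) *
        (\<omega> (map (\<lambda>i. xs ! \<sigma> i) [0..<p]) (map (\<lambda>i. ys ! \<tau> i) [0..<p]) *
         \<eta> (map (\<lambda>i. xs ! \<sigma> i) [p..<p + q]) (map (\<lambda>i. ys ! \<tau> i) [p..<p + q])))
     / (fact p * fact q)\<^sup>2 else 0)"

lemma dform_prod_tensor:
  "dform_prod p q (\<lambda>xs ys. \<theta>\<^sub>1 xs * \<theta>\<^sub>2 ys) (\<lambda>xs ys. \<theta>\<^sub>3 xs * \<theta>\<^sub>4 ys)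
     = (\<lambda>xs ys. wedge p q \<theta>\<^sub>1 \<theta>\<^sub>3 xs * wedge p q \<theta>\<^sub>2 \<theta>\<^sub>4 ys)"
  by (auto simp: fun_eq_iff dform_prod_def wedge_def sum_product power2_eq_square
      intro!: sum.cong)

definition dform_one :: "'v dform" where
  "dform_one xs ys = (if xs = [] \<and> ys = [] then 1 else 0)"

primrec dform_pow :: "'v dform \<Rightarrow> nat \<Rightarrow> 'v dform" where
  "dform_pow G 0 = dform_one"
| "dform_pow G (Suc i) = dform_prod 1 i G (dform_pow G i)"

definition orthonormal_basis :: "'v::real_vector dform \<Rightarrow> 'v set \<Rightarrow> 'v set \<Rightarrow> bool" where
  "orthonormal_basis G T E \<longleftrightarrow> finite E \<and> E \<subseteq> T \<and> span E = T \<and>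
     (\<forall>u\<in>E. \<forall>v\<in>E. G [u] [v] = (if u = v then 1 else 0))"

text \<open>
  The value does not depend on the choice of the basis.  On double forms of order \<open>0\<close>, which vanish
  on nonempty lists, the contraction is \<open>0\<close>.
\<close>

definition contraction :: "'v::real_vector dform \<Rightarrow> 'v set \<Rightarrow> 'v dform \<Rightarrow> 'v dform" where
  "contraction G T \<omega> xs ys = (\<Sum>e\<in>(SOME E. orthonormal_basis G T E). \<omega> (e # xs) (e # ys))"

definition trace_free_space :: "'v::real_vector dform \<Rightarrow> nat \<Rightarrow> 'v set \<Rightarrow> 'v dform set" where
  "trace_free_space G r T = {\<omega> \<in> dform_space r T. contraction G T \<omega> = 0}"


section \<open>Smooth manifolds\<close>

text \<open>For an open set \<open>S\<close> and a finite-dimensional domain, this is membership in \<open>C\<^sup>k(S)\<close>.\<close>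

primrec Ck_on :: "nat \<Rightarrow> 'a set \<Rightarrow> ('a::real_normed_vector \<Rightarrow> 'b::real_normed_vector) \<Rightarrow> bool" where
  "Ck_on 0 S f \<longleftrightarrow> continuous_on S f"
| "Ck_on (Suc k) S f \<longleftrightarrow> (\<forall>x\<in>S. f differentiable (at x)) \<and>
     (\<forall>v. Ck_on k S (\<lambda>x. frechet_derivative f (at x) v))"

definition smooth_on :: "'a set \<Rightarrow> ('a::real_normed_vector \<Rightarrow> 'b::real_normed_vector) \<Rightarrow> bool" where
  "smooth_on S f \<longleftrightarrow> (\<forall>k. Ck_on k S f)"

text \<open>A chart is a pair of a domain and a map, whose values outside the domain are irrelevant.\<close>

type_synonym ('a, 'n) chart = "'a set \<times> ('a \<Rightarrow> real ^ 'n)"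

definition inv_chart :: "('a, 'n::finite) chart \<Rightarrow> real ^ 'n \<Rightarrow> 'a" where
  "inv_chart c = inv_into (fst c) (snd c)"

definition transition :: "('a, 'n::finite) chart \<Rightarrow> ('a, 'n) chart \<Rightarrow> real ^ 'n \<Rightarrow> real ^ 'n" where
  "transition c d = snd d \<circ> inv_chart c"

text \<open>
  A smooth manifold of dimension \<open>CARD('n)\<close>, given by a smooth atlas, which need not be maximal.
\<close>

definition smooth_manifold :: "'a topology \<Rightarrow> ('a, 'n::finite) chart set \<Rightarrow> bool" where
  "smooth_manifold M A \<longleftrightarrow> Hausdorff_space M \<and> second_countable M \<and>
     (\<Union>c\<in>A. fst c) = topspace M \<and>
     (\<forall>c\<in>A. openin M (fst c) \<and> open (snd c ` fst c) \<and>
        homeomorphic_map (subtopology M (fst c)) (top_of_set (snd c ` fst c)) (snd c)) \<and>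
     (\<forall>c\<in>A. \<forall>d\<in>A. smooth_on (snd c ` (fst c \<inter> fst d)) (transition c d))"

definition smooth_function :: "('a, 'n::finite) chart set \<Rightarrow> ('a \<Rightarrow> real) \<Rightarrow> bool" where
  "smooth_function A f \<longleftrightarrow> (\<forall>c\<in>A. smooth_on (snd c ` fst c) (f \<circ> inv_chart c))"

text \<open>
  A tangent vector at \<open>x\<close> is the family of its coordinate vectors in all charts around \<open>x\<close>
  (with value \<open>0\<close> at all other arguments), which are related by the derivatives of the transition
  maps.  Vector space operations are those of functions.
\<close>

type_synonym ('a, 'n) tvec = "('a, 'n) chart \<Rightarrow> real ^ 'n"

definition tangent_space :: "('a, 'n::finite) chart set \<Rightarrow> 'a \<Rightarrow> ('a, 'n) tvec set" where
  "tangent_space A x = {v.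
     (\<forall>c. \<not> (c \<in> A \<and> x \<in> fst c) \<longrightarrow> v c = 0) \<and>
     (\<forall>c\<in>A. \<forall>d\<in>A. x \<in> fst c \<and> x \<in> fst d \<longrightarrow>
        v d = frechet_derivative (transition c d) (at (snd c x)) (v c))}"

text \<open>The tangent vector at \<open>x\<close> whose coordinate vector in the chart \<open>c\<close> is \<open>v\<close>.\<close>

definition chart_vector ::
  "('a, 'n::finite) chart set \<Rightarrow> ('a, 'n) chart \<Rightarrow> 'a \<Rightarrow> real ^ 'n \<Rightarrow> ('a, 'n) tvec" where
  "chart_vector A c x v = (\<lambda>d. if d \<in> A \<and> x \<in> fst d
     then frechet_derivative (transition c d) (at (snd c x)) v else 0)"


section \<open>Double forms on a Riemannian manifold\<close>

text \<open>
  Smooth sections of the bundle of double forms of order \<open>p\<close>; their values outside the manifold are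
  irrelevant.  Smoothness is that of all components in charts, where by multilinearity the
  coordinate frames may be replaced by arbitrary constant vector fields.
\<close>

definition double_forms ::
  "'a topology \<Rightarrow> ('a, 'n::finite) chart set \<Rightarrow> nat \<Rightarrow> ('a \<Rightarrow> ('a, 'n) tvec dform) set" where
  "double_forms M A p = {\<omega>.
     (\<forall>x\<in>topspace M. \<omega> x \<in> dform_space p (tangent_space A x)) \<and>
     (\<forall>c\<in>A. \<forall>vs ws. length vs = p \<and> length ws = p \<longrightarrow>
        smooth_on (snd c ` fst c) (\<lambda>y. \<omega> (inv_chart c y)
          (map (chart_vector A c (inv_chart c y)) vs)
          (map (chart_vector A c (inv_chart c y)) ws)))}"

definition riemannian_manifold ::
  "'a topology \<Rightarrow> ('a, 'n::finite) chart set \<Rightarrow> ('a \<Rightarrow> ('a, 'n) tvec dform) \<Rightarrow> bool" where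
  "riemannian_manifold M A g \<longleftrightarrow> smooth_manifold M A \<and> g \<in> double_forms M A 1 \<and>
     (\<forall>x\<in>topspace M. (\<forall>u\<in>tangent_space A x. \<forall>v\<in>tangent_space A x. g x [u] [v] = g x [v] [u]) \<and>
        (\<forall>u\<in>tangent_space A x. u \<noteq> 0 \<longrightarrow> g x [u] [u] > 0))"

definition trace_free_forms ::
  "'a topology \<Rightarrow> ('a, 'n::finite) chart set \<Rightarrow> ('a \<Rightarrow> ('a, 'n) tvec dform) \<Rightarrow> nat \<Rightarrow>
     ('a \<Rightarrow> ('a, 'n) tvec dform) set" where
  "trace_free_forms M A g r = {\<omega> \<in> double_forms M A r.
     \<forall>x\<in>topspace M. \<omega> x \<in> trace_free_space (g x) r (tangent_space A x)}"

end

theory Submission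
  imports Defs
begin

text \<open>
  The proof is representation theory of \<open>sl\<^sub>2\<close>, done separately in each tangent space \<open>T\<close>, of
  dimension \<open>n\<close>.  Let \<open>L\<close> be the product with the metric and \<open>c\<close> the Ricci contraction.  On
  double forms of order \<open>q\<close> they satisfy \<open>c L - L c = n - 2 q\<close>
  (\<open>contraction_dform_prod_metric\<close>).  By induction, for a trace free \<open>\<omega>\<close> of order \<open>r\<close>,
  \<open>c (g\<^sup>i \<omega>) = i (n - 2 r - i + 1) g\<^sup>i\<^sup>-\<^sup>1 \<omega>\<close> (\<open>contraction_gpow\<close>), so \<open>c\<^sup>k (g\<^sup>i \<omega>)\<close> is an explicit
  multiple of \<open>g\<^sup>i\<^sup>-\<^sup>k \<omega>\<close> for \<open>k \<le> i\<close>, and it vanishes for \<open>k > i\<close>.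

  The factor \<open>n - 2 r - i + 1\<close> is \<open>0\<close> for \<open>i = n - 2 r + 1\<close>, which can occur when \<open>2 p > n\<close>.  This
  does no harm: double forms of order larger than \<open>n\<close> vanish, so for \<open>i + 2 r > n\<close> already
  \<open>g\<^sup>i \<omega> = 0\<close> (\<open>gpow_nonzero_bound\<close>).  The same bound makes the sum of the spaces
  \<open>g\<^sup>q\<^sup>-\<^sup>r E\<^sup>r\<^sup>,\<^sup>r\<close> direct: they consist of eigenvectors of \<open>c L\<close> with eigenvalues
  \<open>(q - r + 1) (n - q - r)\<close>, and two of these agree for distinct \<open>r\<close> and \<open>s\<close> only if
  \<open>r + s = n + 1\<close>, where one of the spaces is \<open>0\<close> (\<open>gpow_sum_direct\<close>).

  Hence \<open>c\<^sup>k \<omega>\<close> is the sum over \<open>r \<le> p - k\<close> of multiples of \<open>g\<^sup>p\<^sup>-\<^sup>k\<^sup>-\<^sup>r \<omega>\<^sub>r\<close>, the factor being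
  nonzero whenever \<open>g\<^sup>p\<^sup>-\<^sup>r \<omega>\<^sub>r \<noteq> 0\<close>.  If the components with \<open>1 \<le> r\<close> vanish, only the term with
  \<open>\<omega>\<^sub>0\<close> is left, which is a function times \<open>g\<^sup>p\<^sup>-\<^sup>k\<close>.  Conversely, if the sum is
  \<open>\<lambda> g\<^sup>p\<^sup>-\<^sup>k\<close>, move this term into the component of order \<open>0\<close> and use directness.

  The work below the level of this algebra is to derive the commutation relation and the
  associativity needed for \<open>g\<^sup>i \<omega> = L (g\<^sup>i\<^sup>-\<^sup>1 \<omega>)\<close> from the definition of the product as a
  sum over permutations, and to see that tangent spaces have orthonormal bases with \<open>n\<close> elements.
\<close>

section \<open>Alternating forms\<close>

lemma alternating_formsD:
  assumes "\<alpha> \<in> alternating_forms p T"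
  shows "\<not> (length xs = p \<and> set xs \<subseteq> T) \<Longrightarrow> \<alpha> xs = 0"
    and "length xs = p \<Longrightarrow> set xs \<subseteq> T \<Longrightarrow> i < p \<Longrightarrow> u \<in> T \<Longrightarrow> v \<in> T \<Longrightarrow>
        \<alpha> (xs[i := a *\<^sub>R u + b *\<^sub>R v]) = a * \<alpha> (xs[i := u]) + b * \<alpha> (xs[i := v])"
    and "length xs = p \<Longrightarrow> set xs \<subseteq> T \<Longrightarrow> i < j \<Longrightarrow> j < p \<Longrightarrow> xs ! i = xs ! j \<Longrightarrow> \<alpha> xs = 0"
  using assms unfolding alternating_forms_def mem_Collect_eq by blast+

lemma alternating_forms_repeat':
  assumes "\<alpha> \<in> alternating_forms p T" "i \<noteq> j" "i < p" "j < p" "xs ! i = xs ! j"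
  shows "\<alpha> xs = 0"
  using alternating_formsD(1)[OF assms(1), of xs] alternating_formsD(3)[OF assms(1), of xs i j]
    alternating_formsD(3)[OF assms(1), of xs j i] assms by (metis nat_neq_iff)

text \<open>
  Polarization: expand \<open>\<alpha>\<close> with \<open>u + v\<close> at both positions.  If some entry is outside \<open>T\<close>, both
  sides are \<open>0\<close>.
\<close>

lemma alternating_forms_swap:
  assumes \<alpha>: "\<alpha> \<in> alternating_forms p T" and T: "subspace T"
    and ij: "i < p" "j < p" "i \<noteq> j"
  shows "\<alpha> (xs[i := u, j := v]) = - \<alpha> (xs[i := v, j := u])"
proof (cases "length xs = p \<and> set (xs[i := u, j := v]) \<subseteq> T")
  case False
  have "mset (xs[i := u, j := v]) = mset (xs[i := v, j := u])" if "length xs = p"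
  proof -
    let ?ys = "xs[i := u, j := v]"
    have "xs[i := v, j := u] = ?ys[i := ?ys ! j, j := ?ys ! i]"
      using ij that by (simp add: list_eq_iff_nth_eq nth_list_update)
    then show ?thesis
      using mset_swap[of j ?ys i] ij that by (metis length_list_update)
  qed
  then have "\<not> (length (xs[i := v, j := u]) = p \<and> set (xs[i := v, j := u]) \<subseteq> T)"
    using False by (metis length_list_update mset_eq_setD)
  then show ?thesis
    using False alternating_formsD(1)[OF \<alpha>] by (metis length_list_update minus_zero)
next
  case True
  let ?f = "\<lambda>a b. xs[i := a, j := b]"
  have len: "length xs = p" using True by simp
  have uv: "u \<in> T" "v \<in> T"
    using True ij len by (metis length_list_update nth_list_update_eq nth_list_update_neq nth_mem subsetD)+
  have sub: "set (?f a b) \<subseteq> T" if "a \<in> T" "b \<in> T" for a b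
  proof -
    have "?f a b = (xs[i := u, j := v])[i := a, j := b]"
      using ij by (metis list_update_overwrite list_update_swap)
    then show ?thesis
      using True that by (metis set_update_subsetI)
  qed
  have swapi: "?f a b = (?f a' b)[i := a]" for a a' b
    using ij by (metis list_update_overwrite list_update_swap)
  have uvT: "u + v \<in> T" using uv T subspace_add by blast
  have rep: "\<alpha> (?f a a) = 0" for a
    using alternating_forms_repeat'[OF \<alpha>, of i j] ij len by simp
  have l1: "\<alpha> (?f (u + v) b) = \<alpha> (?f u b) + \<alpha> (?f v b)" if "b \<in> T" for b
    using alternating_formsD(2)[OF \<alpha>, of "?f u b" i u v 1 1] sub[OF uv(1) that] len ij uv
    by (simp flip: swapi)
  have l2: "\<alpha> (?f a (u + v)) = \<alpha> (?f a u) + \<alpha> (?f a v)" if "a \<in> T" for a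
    using alternating_formsD(2)[OF \<alpha>, of "?f a u" j u v 1 1] sub[OF that uv(1)] len ij uv
    by simp
  have "0 = \<alpha> (?f (u + v) (u + v))" by (simp add: rep)
  also have "\<dots> = \<alpha> (?f u v) + \<alpha> (?f v u)"
    using l1[OF uvT] l2[OF uv(1)] l2[OF uv(2)] by (simp add: rep)
  finally show ?thesis by simp
qed

lemma map_comp_transpose_nth:
  assumes "distinct L" "i < length L" "j < length L" "i \<noteq> j"
  shows "map (f \<circ> Transposition.transpose (L ! i) (L ! j)) L = (map f L)[i := f (L ! j), j := f (L ! i)]"
  using assms by (auto simp: list_eq_iff_nth_eq nth_list_update nth_eq_iff_index_eq Transposition.transpose_def)

text \<open>
  The index list \<open>L\<close> is arbitrary because blocks that do not start at \<open>0\<close> occur in products.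
\<close>

lemma alternating_forms_permute:
  assumes \<alpha>: "\<alpha> \<in> alternating_forms (length L) T" and T: "subspace T" and L: "distinct L"
    and \<rho>: "\<rho> permutes set L"
  shows "\<alpha> (map (f \<circ> \<rho>) L) = of_int (sign \<rho>) * \<alpha> (map f L)"
  using \<rho> finite_set
proof (induction arbitrary: f rule: permutes_induct)
  case id
  then show ?case by (simp add: sign_id)
next
  case (swap a b \<rho>)
  then obtain i j where ij: "i < length L" "j < length L" "i \<noteq> j" "a = L ! i" "b = L ! j"
    by (metis in_set_conv_nth)
  have "\<alpha> (map (f \<circ> (Transposition.transpose a b \<circ> \<rho>)) L) = of_int (sign \<rho>) * \<alpha> (map (f \<circ> Transposition.transpose a b) L)"
    using swap.IH[of "f \<circ> Transposition.transpose a b"] unfolding comp_assoc .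
  also have "map (f \<circ> Transposition.transpose a b) L = (map f L)[i := f b, j := f a]"
    using map_comp_transpose_nth[OF L] ij by blast
  also have "\<alpha> \<dots> = - \<alpha> ((map f L)[i := f a, j := f b])"
    using alternating_forms_swap[OF \<alpha> T] ij by blast
  also have "(map f L)[i := f a, j := f b] = map f L"
    using ij by (metis length_map list_update_id nth_map)
  finally have *: "\<alpha> (map (f \<circ> (Transposition.transpose a b \<circ> \<rho>)) L)
      = of_int (sign \<rho>) * - \<alpha> (map f L)" .
  have sg: "sign (Transposition.transpose a b \<circ> \<rho>) = - sign \<rho>"
    using swap.hyps by (subst sign_compose)
      (auto simp: permutation_swap_id sign_swap_id intro: permutes_imp_permutation[OF finite_set])
  show ?case unfolding * sg by simp
qed

lemma subspace_alternating_forms: "subspace (alternating_forms p T)"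
  unfolding subspace_def alternating_forms_def
  by (auto simp: scaleR_fun_def algebra_simps)

lemma alternating_forms_cmult:
  assumes "f \<in> alternating_forms p T"
  shows "(\<lambda>xs. c * f xs) \<in> alternating_forms p T"
  using subspace_scale[OF subspace_alternating_forms assms, of c] by (simp add: scaleR_fun_def)

lemma subspace_dform_space: "subspace (dform_space p T)"
proof -
  note s = subspace_alternating_forms
  have 0: "(\<lambda>xs. 0) \<in> alternating_forms p T" 
    using subspace_0[OF s[of p T]] by (simp add: zero_fun_def)
  have a: "(\<lambda>xs. f xs + h xs) \<in> alternating_forms p T"
    if "f \<in> alternating_forms p T" "h \<in> alternating_forms p T" for f h
    using subspace_add[OF s that] by (simp add: plus_fun_def)
  show ?thesis
    unfolding subspace_def dform_space_def by (auto simp: scaleR_fun_def 0 intro: a alternating_forms_cmult subspace_add[OF s] subspace_0[OF s])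
qed

lemma alternating_forms_Cons:
  assumes "\<alpha> \<in> alternating_forms (Suc p) T" "e \<in> T"
  shows "(\<lambda>xs. \<alpha> (e # xs)) \<in> alternating_forms p T"
  unfolding alternating_forms_def mem_Collect_eq
proof (intro conjI allI impI)
  fix xs assume "\<not> (length xs = p \<and> set xs \<subseteq> T)"
  then show "\<alpha> (e # xs) = 0" using alternating_formsD(1)[OF assms(1), of "e # xs"] by simp
next
  fix xs i u v a b
  assume "length xs = p \<and> set xs \<subseteq> T \<and> i < p \<and> u \<in> T \<and> v \<in> T"
  then show "\<alpha> (e # xs[i := a *\<^sub>R u + b *\<^sub>R v]) = a * \<alpha> (e # xs[i := u]) + b * \<alpha> (e # xs[i := v])"
    using alternating_formsD(2)[OF assms(1), of "e # xs" "Suc i" u v a b] assms(2) by simp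
next
  fix xs i j
  assume "length xs = p \<and> set xs \<subseteq> T \<and> i < j \<and> j < p \<and> xs ! i = xs ! j"
  then show "\<alpha> (e # xs) = 0"
    using alternating_formsD(3)[OF assms(1), of "e # xs" "Suc i" "Suc j"] assms(2) by simp
qed

lemma dform_spaceD:
  assumes "\<omega> \<in> dform_space p T"
  shows "(\<lambda>xs. \<omega> xs ys) \<in> alternating_forms p T" "\<omega> xs \<in> alternating_forms p T"
  using assms unfolding dform_space_def by auto

lemma dform_space_outside:
  assumes "\<omega> \<in> dform_space p T" "\<not> (length xs = p \<and> set xs \<subseteq> T) \<or> \<not> (length ys = p \<and> set ys \<subseteq> T)"
  shows "\<omega> xs ys = 0"
  using assms(2) alternating_formsD(1)[OF dform_spaceD(1)[OF assms(1)]]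
    alternating_formsD(1)[OF dform_spaceD(2)[OF assms(1)]] by blast

lemma dform_space_0:
  assumes "\<omega> \<in> dform_space 0 T"
  shows "\<omega> = \<omega> [] [] *\<^sub>R dform_one"
  using dform_space_outside[OF assms] by (auto simp: fun_eq_iff scaleR_fun_def dform_one_def)

lemma dform_one_in: "dform_one \<in> dform_space 0 T"
  by (auto simp: dform_space_def alternating_forms_def dform_one_def)

lemma linear_dform_prod: "linear (dform_prod p q \<omega>)"
proof (rule linearI)
  show "dform_prod p q \<omega> (\<eta> + \<theta>) = dform_prod p q \<omega> \<eta> + dform_prod p q \<omega> \<theta>" for \<eta> \<theta>
    by (intro ext) (simp add: dform_prod_def algebra_simps sum.distrib add_divide_distrib)
  show "dform_prod p q \<omega> (a *\<^sub>R \<eta>) = a *\<^sub>R dform_prod p q \<omega> \<eta>" for a \<eta>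
    by (intro ext) (simp add: dform_prod_def scaleR_fun_def sum_distrib_left mult_ac)
qed

lemma linear_contraction: "linear (contraction G T)"
  by (rule linearI) (auto simp: contraction_def fun_eq_iff scaleR_fun_def sum.distrib sum_distrib_left)

lemma contraction_funpow_zero: "(contraction G T ^^ k) 0 = 0"
proof (induction k)
  case (Suc k)
  then show ?case by (simp only: funpow.simps o_apply linear_0[OF linear_contraction])
qed simp

text \<open>
  Antisymmetrizing a form that is alternating already gives \<open>r!\<close> equal terms in each block, which the
  normalization cancels.
\<close>

lemma dform_prod_one:
  assumes \<omega>: "\<omega> \<in> dform_space r T" and T: "subspace T"
  shows "dform_prod 0 r dform_one \<omega> = \<omega>"
proof (intro ext)
  fix xs ys :: "'a list"
  show "dform_prod 0 r dform_one \<omega> xs ys = \<omega> xs ys"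
  proof (cases "length xs = r \<and> length ys = r")
    case False
    then show ?thesis using dform_space_outside[OF \<omega>] by (auto simp: dform_prod_def)
  next
    case True
    have xs: "map ((!) xs) [0..<r] = xs" and ys: "map ((!) ys) [0..<r] = ys"
      using True by (metis map_nth)+
    have "\<omega> (map (\<lambda>i. xs ! \<sigma> i) [0..<r]) (map (\<lambda>i. ys ! \<tau> i) [0..<r])
        = of_int (sign \<sigma> * sign \<tau>) * \<omega> xs ys" if "\<sigma> permutes {..<r}" "\<tau> permutes {..<r}" for \<sigma> \<tau>
    proof -
      have "(\<lambda>xs. \<omega> xs zs) (map ((!) xs \<circ> \<sigma>) [0..<r]) = of_int (sign \<sigma>) * \<omega> (map ((!) xs) [0..<r]) zs" for zs
        using that by (intro alternating_forms_permute[where T = T])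
          (auto simp: T atLeast0LessThan dform_spaceD[OF \<omega>])
      moreover have "\<omega> xs (map ((!) ys \<circ> \<tau>) [0..<r]) = of_int (sign \<tau>) * \<omega> xs (map ((!) ys) [0..<r])"
        using that by (intro alternating_forms_permute[where T = T])
          (auto simp: T atLeast0LessThan dform_spaceD[OF \<omega>])
      ultimately show ?thesis by (simp add: xs ys o_def)
    qed
    then have "(\<Sum>\<sigma> | \<sigma> permutes {..<r}. \<Sum>\<tau> | \<tau> permutes {..<r}. of_int (sign \<sigma> * sign \<tau>) *
        \<omega> (map (\<lambda>i. xs ! \<sigma> i) [0..<r]) (map (\<lambda>i. ys ! \<tau> i) [0..<r]))
      = (\<Sum>\<sigma> | \<sigma> permutes {..<r}. \<Sum>\<tau> | \<tau> permutes {..<r}. \<omega> xs ys)"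
      by (intro sum.cong refl) (simp add: mult.assoc[symmetric] flip: of_int_mult, simp add: mult_ac)
    also have "\<dots> = (fact r)\<^sup>2 * \<omega> xs ys"
      by (simp add: card_permutations[where n = r] power2_eq_square)
    finally show ?thesis
      using True by (simp add: dform_prod_def dform_one_def)
  qed
qed

section \<open>Associativity of the exterior product\<close>

lemma sign_map_permutation:
  assumes p: "p permutes S" and S: "finite S" and f: "inj_on f S"
  shows "sign (map_permutation S f p) = sign p"
  using p S
proof (induction rule: permutes_induct)
  case id
  show ?case unfolding map_permutation_id'[OF f] by (simp only: sign_id)
next
  case (swap a b p)
  have q: "map_permutation S f p permutes f ` S"
    using swap.hyps f by (intro map_permutation_permutes) (auto simp: inj_on_imp_bij_betw)
  have "permutation (map_permutation S f p)" "permutation p"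
    using permutes_imp_permutation[OF _ q] permutes_imp_permutation[OF S] swap.hyps S by auto
  moreover have "f a = f b \<longleftrightarrow> a = b"
    using f swap.hyps by (meson inj_on_eq_iff)
  ultimately have "sign (Transposition.transpose (f a) (f b) \<circ> map_permutation S f p)
      = sign (Transposition.transpose a b \<circ> p)"
    using swap.IH by (simp only: sign_compose permutation_swap_id sign_swap_id)
  then show ?case
    using swap.hyps f by (simp only: map_permutation_compose' map_permutation_transpose)
qed

text \<open>
  Antisymmetrization in both blocks of arguments.  Arguments are functions of an index instead of
  lists, so that permuting a subset \<open>S\<close> of the positions is a composition, too.
\<close>

definition alt_sum :: "'i set \<Rightarrow> (('i \<Rightarrow> 'v) \<Rightarrow> ('i \<Rightarrow> 'v) \<Rightarrow> real) \<Rightarrow> ('i \<Rightarrow> 'v) \<Rightarrow> ('i \<Rightarrow> 'v) \<Rightarrow> real" where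
  "alt_sum S \<Phi> f h = (\<Sum>\<sigma> | \<sigma> permutes S. \<Sum>\<tau> | \<tau> permutes S.
     of_int (sign \<sigma> * sign \<tau>) * \<Phi> (f \<circ> \<sigma>) (h \<circ> \<tau>))"

text \<open>
  Permuting the entries of a sublist of arguments amounts to permuting the positions that it
  occupies; this turns a product inside another one into an antisymmetrization over a subset of all positions.
\<close>

lemma sum_permutations_list:
  assumes L: "distinct (L :: 'i list)"
  shows "(\<Sum>\<sigma> | \<sigma> permutes {..<length L}. of_int (sign \<sigma>) * \<Phi> (map (\<lambda>i. map f L ! \<sigma> i) [0..<length L]))
       = (\<Sum>\<rho> | \<rho> permutes set L. of_int (sign \<rho>) * \<Phi> (map (f \<circ> \<rho>) L))"
proof -
  let ?N = "{..<length L}"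
  have inj: "inj_on (nth L) ?N" using L by (simp add: inj_on_nth)
  have bij: "bij_betw (nth L) ?N (set L)"
    using L by (intro bij_betw_nth) auto
  have bij': "bij_betw (inv_into ?N (nth L)) (set L) ?N"
    by (rule bij_betw_inv_into[OF bij])
  have m: "map (\<lambda>i. map f L ! \<sigma> i) [0..<length L] = map (f \<circ> map_permutation ?N (nth L) \<sigma>) L"
    if "\<sigma> permutes ?N" for \<sigma>
  proof -
    have "\<sigma> i < length L" if "i < length L" for i
      using permutes_in_image[OF \<open>\<sigma> permutes ?N\<close>, of i] that by simp
    then show ?thesis
      by (intro nth_equalityI) (simp_all add: map_permutation_apply[OF inj])
  qed
  show ?thesis
  proof (rule sum.reindex_bij_witness[where j = "map_permutation ?N (nth L)"
        and i = "map_permutation (set L) (inv_into ?N (nth L))"])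
    fix \<sigma> assume s: "\<sigma> \<in> {\<sigma>. \<sigma> permutes ?N}"
    show "map_permutation (set L) (inv_into ?N ((!) L)) (map_permutation ?N ((!) L) \<sigma>) = \<sigma>"
      using s inj by (intro map_permutation_compose_inv[OF bij]) auto
    show "map_permutation ?N ((!) L) \<sigma> \<in> {\<rho>. \<rho> permutes set L}"
      using s map_permutation_permutes[OF bij] by auto
    show "of_int (sign (map_permutation ?N ((!) L) \<sigma>)) * \<Phi> (map (f \<circ> map_permutation ?N ((!) L) \<sigma>) L)
        = of_int (sign \<sigma>) * \<Phi> (map (\<lambda>i. map f L ! \<sigma> i) [0..<length L])"
      using s by (simp add: m sign_map_permutation[OF _ _ inj])
  next
    fix \<rho> assume r: "\<rho> \<in> {\<rho>. \<rho> permutes set L}"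
    show "map_permutation (set L) (inv_into ?N ((!) L)) \<rho> \<in> {\<sigma>. \<sigma> permutes ?N}"
      using r map_permutation_permutes[OF bij'] by auto
    show "map_permutation ?N ((!) L) (map_permutation (set L) (inv_into ?N ((!) L)) \<rho>) = \<rho>"
      using r by (intro map_permutation_compose_inv[OF bij']) (auto simp: bij_betw_inv_into_right[OF bij])
  qed
qed

lemma dform_prod_alt_sum:
  fixes f h :: "'i \<Rightarrow> 'v"
  assumes L: "distinct L" "length L = p + q"
  shows "dform_prod p q \<omega> \<eta> (map f L) (map h L)
    = alt_sum (set L) (\<lambda>f h. \<omega> (map f (take p L)) (map h (take p L)) *
        \<eta> (map f (drop p L)) (map h (drop p L))) f h / (fact p * fact q)\<^sup>2"
proof -
  let ?\<Psi> = "\<lambda>xs ys. \<omega> (take p xs) (take p ys) * \<eta> (drop p xs) (drop p ys)"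
  let ?N = "{..<p + q}"
  let ?m = "\<lambda>f \<sigma>. map (\<lambda>i. map f L ! \<sigma> i) [0..<p + q]"
  have len: "length (map f L) = p + q \<and> length (map h L) = p + q"
    using L by simp
  have eq: "dform_prod p q \<omega> \<eta> (map f L) (map h L)
      = (\<Sum>\<sigma> | \<sigma> permutes ?N. \<Sum>\<tau> | \<tau> permutes ?N. of_int (sign \<sigma> * sign \<tau>) * ?\<Psi> (?m f \<sigma>) (?m h \<tau>))
        / (fact p * fact q)\<^sup>2"
    unfolding dform_prod_def if_P[OF len] by (simp add: take_map drop_map)
  have "(\<Sum>\<sigma> | \<sigma> permutes ?N. \<Sum>\<tau> | \<tau> permutes ?N. of_int (sign \<sigma> * sign \<tau>) * ?\<Psi> (?m f \<sigma>) (?m h \<tau>))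
    = (\<Sum>\<sigma> | \<sigma> permutes ?N. of_int (sign \<sigma>) *
      (\<Sum>\<tau> | \<tau> permutes ?N. of_int (sign \<tau>) * ?\<Psi> (?m f \<sigma>) (?m h \<tau>)))"
    by (simp only: sum_distrib_left mult.assoc of_int_mult)
  also have "\<dots> = (\<Sum>\<rho> | \<rho> permutes set L. of_int (sign \<rho>) *
      (\<Sum>\<tau> | \<tau> permutes ?N. of_int (sign \<tau>) * ?\<Psi> (map (f \<circ> \<rho>) L) (?m h \<tau>)))"
    using sum_permutations_list[OF L(1), where f = f and
        \<Phi> = "\<lambda>xs. \<Sum>\<tau> | \<tau> permutes ?N. of_int (sign \<tau>) * ?\<Psi> xs (?m h \<tau>)"] L(2) by simp
  also have "\<dots> = (\<Sum>\<rho> | \<rho> permutes set L. of_int (sign \<rho>) *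
      (\<Sum>\<tau> | \<tau> permutes set L. of_int (sign \<tau>) * ?\<Psi> (map (f \<circ> \<rho>) L) (map (h \<circ> \<tau>) L)))"
  proof (intro sum.cong refl arg_cong2[where f = "(*)"])
    fix \<rho>
    show "(\<Sum>\<tau> | \<tau> permutes ?N. of_int (sign \<tau>) * ?\<Psi> (map (f \<circ> \<rho>) L) (?m h \<tau>))
        = (\<Sum>\<tau> | \<tau> permutes set L. of_int (sign \<tau>) * ?\<Psi> (map (f \<circ> \<rho>) L) (map (h \<circ> \<tau>) L))"
      using sum_permutations_list[OF L(1), where f = h and \<Phi> = "?\<Psi> (map (f \<circ> \<rho>) L)"] L(2) by simp
  qed
  also have "\<dots> = alt_sum (set L) (\<lambda>f h. \<omega> (map f (take p L)) (map h (take p L)) *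
        \<eta> (map f (drop p L)) (map h (drop p L))) f h"
    by (simp only: alt_sum_def sum_distrib_left mult.assoc of_int_mult take_map drop_map)
  finally show ?thesis by (simp only: eq)
qed

text \<open>
  A permutation of \<open>S\<close> is one of \<open>U\<close>, so for each pair of inner permutations the outer sum
  can be reindexed and absorbs it; the number of such pairs is the factor.
\<close>

lemma alt_sum_alt_sum:
  assumes SU: "S \<subseteq> U" and U: "finite U"
  shows "alt_sum U (alt_sum S \<Phi>) f h = (fact (card S))\<^sup>2 * alt_sum U \<Phi> f h"
proof -
  let ?U = "{\<sigma>. \<sigma> permutes U}" and ?S = "{\<sigma>. \<sigma> permutes S}"
  define t where "t \<sigma> \<tau> = of_int (sign \<sigma> * sign \<tau>) * \<Phi> (f \<circ> \<sigma>) (h \<circ> \<tau>)" for \<sigma> \<tau>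
  have S: "finite S" using SU U finite_subset by blast
  have perm: "\<sigma>' permutes U" if "\<sigma>' permutes S" for \<sigma>'
    using that SU permutes_subset by blast
  have "alt_sum U (alt_sum S \<Phi>) f h
      = (\<Sum>\<sigma>\<in>?U. \<Sum>\<tau>\<in>?U. \<Sum>\<sigma>'\<in>?S. \<Sum>\<tau>'\<in>?S. t (\<sigma> \<circ> \<sigma>') (\<tau> \<circ> \<tau>'))"
    unfolding alt_sum_def sum_distrib_left
  proof (intro sum.cong refl)
    fix \<sigma> \<tau> \<sigma>' \<tau>'
    assume "\<sigma> \<in> ?U" "\<tau> \<in> ?U" "\<sigma>' \<in> ?S" "\<tau>' \<in> ?S"
    then have "permutation \<sigma>" "permutation \<tau>" "permutation \<sigma>'" "permutation \<tau>'"
      using S U permutes_imp_permutation by blast+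
    then show "of_int (sign \<sigma> * sign \<tau>) * (of_int (sign \<sigma>' * sign \<tau>') * \<Phi> (f \<circ> \<sigma> \<circ> \<sigma>') (h \<circ> \<tau> \<circ> \<tau>'))
        = t (\<sigma> \<circ> \<sigma>') (\<tau> \<circ> \<tau>')"
      by (simp add: t_def sign_compose comp_assoc)
  qed
  also have "\<dots> = (\<Sum>\<sigma>'\<in>?S. \<Sum>\<tau>'\<in>?S. \<Sum>\<sigma>\<in>?U. \<Sum>\<tau>\<in>?U. t (\<sigma> \<circ> \<sigma>') (\<tau> \<circ> \<tau>'))"
  proof -
    have "(\<Sum>\<sigma>\<in>?U. \<Sum>\<tau>\<in>?U. \<Sum>\<sigma>'\<in>?S. \<Sum>\<tau>'\<in>?S. t (\<sigma> \<circ> \<sigma>') (\<tau> \<circ> \<tau>'))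
        = (\<Sum>\<sigma>\<in>?U. \<Sum>\<sigma>'\<in>?S. \<Sum>\<tau>\<in>?U. \<Sum>\<tau>'\<in>?S. t (\<sigma> \<circ> \<sigma>') (\<tau> \<circ> \<tau>'))"
      by (intro sum.cong refl sum.swap)
    also have "\<dots> = (\<Sum>\<sigma>'\<in>?S. \<Sum>\<sigma>\<in>?U. \<Sum>\<tau>'\<in>?S. \<Sum>\<tau>\<in>?U. t (\<sigma> \<circ> \<sigma>') (\<tau> \<circ> \<tau>'))"
      by (subst sum.swap) (intro sum.cong refl sum.swap)
    also have "\<dots> = (\<Sum>\<sigma>'\<in>?S. \<Sum>\<tau>'\<in>?S. \<Sum>\<sigma>\<in>?U. \<Sum>\<tau>\<in>?U. t (\<sigma> \<circ> \<sigma>') (\<tau> \<circ> \<tau>'))"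
      by (intro sum.cong refl sum.swap)
    finally show ?thesis .
  qed
  also have "\<dots> = (\<Sum>\<sigma>'\<in>?S. \<Sum>\<tau>'\<in>?S. alt_sum U \<Phi> f h)"
  proof (intro sum.cong refl)
    fix \<sigma>' \<tau>' assume st: "\<sigma>' \<in> ?S" "\<tau>' \<in> ?S"
    have "(\<Sum>\<tau>\<in>?U. t (\<sigma> \<circ> \<sigma>') (\<tau> \<circ> \<tau>')) = (\<Sum>\<tau>\<in>?U. t (\<sigma> \<circ> \<sigma>') \<tau>)" for \<sigma>
      using sum_permutations_compose_right[OF perm, of \<tau>' "t (\<sigma> \<circ> \<sigma>')"] st by simp
    then show "(\<Sum>\<sigma>\<in>?U. \<Sum>\<tau>\<in>?U. t (\<sigma> \<circ> \<sigma>') (\<tau> \<circ> \<tau>')) = alt_sum U \<Phi> f h"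
      using sum_permutations_compose_right[OF perm, of \<sigma>' "\<lambda>\<sigma>. \<Sum>\<tau>\<in>?U. t \<sigma> \<tau>"] st
      by (simp add: alt_sum_def t_def)
  qed
  also have "\<dots> = (fact (card S))\<^sup>2 * alt_sum U \<Phi> f h"
    by (simp add: card_permutations[OF refl S] power2_eq_square)
  finally show ?thesis .
qed

text \<open>
  A factor that does not depend on the positions in \<open>S\<close> passes through the antisymmetrization.
\<close>

lemma alt_sum_mult:
  assumes "\<And>\<sigma> \<tau>. \<sigma> permutes S \<Longrightarrow> \<tau> permutes S \<Longrightarrow> \<Psi> (f \<circ> \<sigma>) (h \<circ> \<tau>) = \<Psi> f h"
  shows "alt_sum S \<Phi> f h * \<Psi> f h = alt_sum S (\<lambda>f h. \<Phi> f h * \<Psi> f h) f h"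
  using assms by (auto simp: alt_sum_def sum_distrib_right mult.assoc intro!: sum.cong)

lemma alt_sum_scale: "alt_sum S (\<lambda>f h. \<Phi> f h / a) f h = alt_sum S \<Phi> f h / a"
  by (simp add: alt_sum_def sum_divide_distrib)

lemma map_comp_permutes_disjoint:
  "\<sigma> permutes S \<Longrightarrow> S \<inter> set L = {} \<Longrightarrow> map (f \<circ> \<sigma>) L = map f L"
  by (auto simp: permutes_def)

lemma dform_prod_wrong_length:
  "\<not> (length xs = p + q \<and> length ys = p + q) \<Longrightarrow> dform_prod p q \<omega> \<eta> xs ys = 0"
  by (auto simp: dform_prod_def)

text \<open>
  Both sides are normalized antisymmetrizations of the same product of three factors: on the left, the
  inner antisymmetrization runs over the first \<open>p + q\<close> positions, on the right over the last
  \<open>q + r\<close> ones, and the outer one absorbs either.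
\<close>

lemma dform_prod_assoc:
  "dform_prod (p + q) r (dform_prod p q \<omega> \<eta>) \<theta> = dform_prod p (q + r) \<omega> (dform_prod q r \<eta> \<theta>)"
proof (intro ext)
  fix xs ys :: "'a list"
  show "dform_prod (p + q) r (dform_prod p q \<omega> \<eta>) \<theta> xs ys
      = dform_prod p (q + r) \<omega> (dform_prod q r \<eta> \<theta>) xs ys"
  proof (cases "length xs = p + q + r \<and> length ys = p + q + r")
    case False
    then show ?thesis by (simp add: dform_prod_wrong_length add.assoc)
  next
    case True
    define L where "L = [0..<p + q + r]"
    have dL: "distinct L" and lL: "length L = p + q + r" by (simp_all add: L_def)
    let ?A = "take p L" and ?B = "take q (drop p L)" and ?C = "drop (p + q) L"
    have xs: "xs = map ((!) xs) L" and ys: "ys = map ((!) ys) L"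
      using True by (auto simp: L_def list_eq_iff_nth_eq)
    let ?\<Phi> = "\<lambda>f h. \<omega> (map f ?A) (map h ?A) * \<eta> (map f ?B) (map h ?B) * \<theta> (map f ?C) (map h ?C)"
    have AB: "take p (take (p + q) L) = ?A" "drop p (take (p + q) L) = ?B"
      by (auto simp: take_drop min_def add.commute)
    have BC: "drop q (drop p L) = ?C"
      by (simp add: add.commute)
    have disj1: "set (take (p + q) L) \<inter> set ?C = {}"
      using dL by (rule set_take_disj_set_drop_if_distinct) simp
    have disj2: "set (drop p L) \<inter> set ?A = {}"
      using set_take_disj_set_drop_if_distinct[OF dL, of p p] by auto
    have card1: "card (set (take (p + q) L)) = p + q"
      using dL lL by (simp add: distinct_card)
    have card2: "card (set (drop p L)) = q + r"
      using dL lL by (simp add: distinct_card)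
    have l1: "dform_prod p q \<omega> \<eta> (map f (take (p + q) L)) (map h (take (p + q) L)) * \<theta> (map f ?C) (map h ?C)
        = alt_sum (set (take (p + q) L)) ?\<Phi> f h / (fact p * fact q)\<^sup>2" for f h
    proof -
      have "alt_sum (set (take (p + q) L)) (\<lambda>f h. \<omega> (map f ?A) (map h ?A) * \<eta> (map f ?B) (map h ?B)) f h
          * \<theta> (map f ?C) (map h ?C) = alt_sum (set (take (p + q) L)) ?\<Phi> f h"
        by (rule alt_sum_mult) (simp only: map_comp_permutes_disjoint[OF _ disj1])
      then show ?thesis
        using dL lL by (subst dform_prod_alt_sum) (simp_all only: AB distinct_take length_take, simp_all)
    qed
    have l2: "\<omega> (map f ?A) (map h ?A) * dform_prod q r \<eta> \<theta> (map f (drop p L)) (map h (drop p L))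
        = alt_sum (set (drop p L)) ?\<Phi> f h / (fact q * fact r)\<^sup>2" for f h
    proof -
      have "alt_sum (set (drop p L)) (\<lambda>f h. \<eta> (map f ?B) (map h ?B) * \<theta> (map f ?C) (map h ?C)) f h
          * \<omega> (map f ?A) (map h ?A) = alt_sum (set (drop p L)) ?\<Phi> f h"
        by (subst alt_sum_mult) (simp_all only: map_comp_permutes_disjoint[OF _ disj2] mult_ac)
      moreover have "dform_prod q r \<eta> \<theta> (map f (drop p L)) (map h (drop p L))
          = alt_sum (set (drop p L)) (\<lambda>f h. \<eta> (map f ?B) (map h ?B) * \<theta> (map f ?C) (map h ?C)) f h
            / (fact q * fact r)\<^sup>2"
        using dL lL by (subst dform_prod_alt_sum) (simp, simp, simp only: BC)
      moreover have "w * d = b / c" if "a * w = b" "d = a / c" for a b c d w :: real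
        using that by (simp add: mult.commute)
      ultimately show ?thesis by metis
    qed
    have "dform_prod (p + q) r (dform_prod p q \<omega> \<eta>) \<theta> (map ((!) xs) L) (map ((!) ys) L)
        = alt_sum (set L) (\<lambda>f h. alt_sum (set (take (p + q) L)) ?\<Phi> f h / (fact p * fact q)\<^sup>2)
            ((!) xs) ((!) ys) / (fact (p + q) * fact r)\<^sup>2"
      by (subst dform_prod_alt_sum[OF dL lL]) (simp only: l1)
    also have "\<dots> = alt_sum (set L) ?\<Phi> ((!) xs) ((!) ys) / (fact p * fact q * fact r)\<^sup>2"
      unfolding alt_sum_scale alt_sum_alt_sum[OF set_take_subset finite_set] card1
      by (simp add: power_mult_distrib)
    also have "\<dots> = alt_sum (set L) (\<lambda>f h. alt_sum (set (drop p L)) ?\<Phi> f h / (fact q * fact r)\<^sup>2)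
            ((!) xs) ((!) ys) / (fact p * fact (q + r))\<^sup>2"
      unfolding alt_sum_scale alt_sum_alt_sum[OF set_drop_subset finite_set] card2
      by (simp add: power_mult_distrib)
    also have "\<dots> = dform_prod p (q + r) \<omega> (dform_prod q r \<eta> \<theta>) (map ((!) xs) L) (map ((!) ys) L)"
      by (subst dform_prod_alt_sum[OF dL lL[unfolded add.assoc]]) (simp only: l2)
    finally show ?thesis by (simp flip: xs ys)
  qed
qed

section \<open>Laplace expansion of the product with a form of order one\<close>

text \<open>
  Up to the factor \<open>q!\<close>, the antisymmetrization of \<open>F x xs\<close> for a family of alternating forms
  \<open>F x\<close> of degree \<open>q\<close>: the first entry of the list replaces its \<open>a\<close>-th entry, which becomes the
  argument \<open>x\<close>.  Compared with deleting the \<open>a\<close>-th entry, this turns the alternating signs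
  of the usual expansion into a single sign for all \<open>a > 0\<close>.
\<close>

definition lap :: "('v \<Rightarrow> 'v form) \<Rightarrow> 'v form" where
  "lap F xs = (\<Sum>a<length xs. (if a = 0 then 1 else -1) * F (xs ! a) (tl (xs[a := hd xs])))"

lemma lap_Nil [simp]: "lap F [] = 0"
  by (simp add: lap_def)

lemma lap_Cons [simp]: "lap F (x # ys) = F x ys - (\<Sum>b<length ys. F (ys ! b) (ys[b := x]))"
  by (simp add: lap_def sum.lessThan_Suc_shift sum_negf del: sum.lessThan_Suc)

text \<open>
  Each permutation of \<open>{0..q}\<close> is a transposition of \<open>0\<close> and some \<open>b\<close> after a
  permutation of \<open>{1..q}\<close>.  Since \<open>F x\<close> is alternating, the \<open>q!\<close> permutations with the same
  \<open>b\<close> contribute equally.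
\<close>

lemma laplace_expansion:
  assumes F: "\<And>x. F x \<in> alternating_forms q T" and T: "subspace T"
    and xs: "length xs = Suc q"
  shows "(\<Sum>\<sigma> | \<sigma> permutes {..<Suc q}. of_int (sign \<sigma>) *
           F (xs ! \<sigma> 0) (map (\<lambda>i. xs ! \<sigma> i) [1..<Suc q])) = fact q * lap F xs"
proof -
  let ?S = "{1..<Suc q}"
  have ins: "{..<Suc q} = insert 0 ?S" by auto
  obtain x ys where xy: "xs = x # ys" and ly: "length ys = q"
    using xs by (metis length_Suc_conv)
  have one: "of_int (sign (Transposition.transpose 0 b \<circ> \<sigma>)) *
           F (xs ! (Transposition.transpose 0 b \<circ> \<sigma>) 0) (map (\<lambda>i. xs ! (Transposition.transpose 0 b \<circ> \<sigma>) i) [1..<Suc q])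
      = (if b = 0 then 1 else -1) * F (xs ! b) (map (\<lambda>i. xs ! Transposition.transpose 0 b i) [1..<Suc q])"
    if \<sigma>: "\<sigma> permutes ?S" for \<sigma> b
  proof -
    have s0: "\<sigma> 0 = 0" using \<sigma> by (simp add: permutes_not_in)
    have "F (xs ! b) (map (((\<lambda>i. xs ! Transposition.transpose 0 b i)) \<circ> \<sigma>) [1..<Suc q])
        = of_int (sign \<sigma>) * F (xs ! b) (map (\<lambda>i. xs ! Transposition.transpose 0 b i) [1..<Suc q])"
      using \<sigma> by (intro alternating_forms_permute[where T = T]) (use F T in \<open>auto simp del: upt_Suc\<close>)
    moreover have "sign (Transposition.transpose 0 b \<circ> \<sigma>) = (if b = 0 then 1 else -1) * sign \<sigma>"
      using \<sigma> by (subst sign_compose) (auto simp: permutation_swap_id sign_swap_id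
          intro: permutes_imp_permutation[rotated])
    ultimately show ?thesis
      by (simp add: s0 o_def flip: of_int_mult)
  qed
  have tail0: "map (\<lambda>i. xs ! i) [1..<Suc q] = ys"
    using ly by (auto simp: xy list_eq_iff_nth_eq simp del: upt_Suc)
  have tail: "map (\<lambda>i. xs ! Transposition.transpose 0 b i) [1..<Suc q] = ys[b - 1 := x]"
    if "0 < b" "b < Suc q" for b
    using that ly by (auto simp: xy list_eq_iff_nth_eq nth_list_update Transposition.transpose_def simp del: upt_Suc)
  have "(\<Sum>\<sigma> | \<sigma> permutes {..<Suc q}. of_int (sign \<sigma>) *
           F (xs ! \<sigma> 0) (map (\<lambda>i. xs ! \<sigma> i) [1..<Suc q]))
      = (\<Sum>b\<in>insert 0 ?S. \<Sum>\<sigma> | \<sigma> permutes ?S.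
           (if b = 0 then 1 else -1) * F (xs ! b) (map (\<lambda>i. xs ! Transposition.transpose 0 b i) [1..<Suc q]))"
    unfolding ins by (subst sum_over_permutations_insert) (simp, simp, intro sum.cong refl one, simp)
  also have "\<dots> = (\<Sum>b\<in>insert 0 ?S. fact q *
           ((if b = 0 then 1 else -1) * F (xs ! b) (map (\<lambda>i. xs ! Transposition.transpose 0 b i) [1..<Suc q])))"
    by (simp add: card_permutations[where n = q] del: upt_Suc)
  also have "\<dots> = fact q * (F x ys + (\<Sum>b\<in>?S. - F (xs ! b) (map (\<lambda>i. xs ! Transposition.transpose 0 b i) [1..<Suc q])))"
    using tail0 by (simp add: xy sum_distrib_left algebra_simps del: upt_Suc)
  also have "(\<Sum>b\<in>?S. - F (xs ! b) (map (\<lambda>i. xs ! Transposition.transpose 0 b i) [1..<Suc q]))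
      = (\<Sum>b<q. - F (ys ! b) (ys[b := x]))"
    by (rule sum.reindex_bij_witness[where i = Suc and j = "\<lambda>b. b - 1"])
       (use tail in \<open>auto simp: xy simp del: upt_Suc\<close>)
  finally show ?thesis by (simp add: xy ly sum_negf)
qed

text \<open>
  In an expansion with two equal entries all terms vanish because of the repetition, except those
  that separate the two entries, and these cancel.
\<close>

lemma lap_alternating:
  assumes F: "\<And>x. F x \<in> alternating_forms q T" and T: "subspace T"
    and lin: "\<And>u v a b ys. u \<in> T \<Longrightarrow> v \<in> T \<Longrightarrow> F (a *\<^sub>R u + b *\<^sub>R v) ys = a * F u ys + b * F v ys"
    and out: "\<And>x ys. x \<notin> T \<Longrightarrow> F x ys = 0"
  shows "lap F \<in> alternating_forms (Suc q) T"
  unfolding alternating_forms_def mem_Collect_eq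
proof (intro conjI allI impI)
  fix xs :: "'a list"
  assume *: "\<not> (length xs = Suc q \<and> set xs \<subseteq> T)"
  show "lap F xs = 0"
  proof (cases xs)
    case (Cons x ys)
    have "\<not> (length ys = q \<and> set ys \<subseteq> T) \<or> x \<notin> T"
      using * Cons by auto
    then have 1: "F x ys = 0"
      using out alternating_formsD(1)[OF F[of x], of ys] by blast
    have 2: "F (ys ! b) (ys[b := x]) = 0" if "b < length ys" for b
    proof (cases "length ys = q \<and> x \<in> T \<and> ys ! b \<in> T")
      case False
      have "x \<in> set (ys[b := x])" using that by (simp add: set_update_memI)
      with False show ?thesis
        using out alternating_formsD(1)[OF F, of "ys[b := x]"] by (metis length_list_update subsetD)
    next
      case True
      then have "\<not> set ys \<subseteq> T" using * Cons by auto
      then obtain j where j: "j < length ys" "ys ! j \<notin> T"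
        by (metis in_set_conv_nth subsetI)
      then have "ys[b := x] ! j \<notin> T" using True by (metis nth_list_update_neq)
      then have "\<not> set (ys[b := x]) \<subseteq> T" using j by (metis length_list_update nth_mem subsetD)
      then show ?thesis using alternating_formsD(1)[OF F, of "ys[b := x]"] by blast
    qed
    show ?thesis using 1 2 by (simp add: Cons)
  qed simp
next
  fix xs :: "'a list" and i u v a b
  assume *: "length xs = Suc q \<and> set xs \<subseteq> T \<and> i < Suc q \<and> u \<in> T \<and> v \<in> T"
  then obtain x ys where Cons: "xs = x # ys" and ys: "length ys = q" "set ys \<subseteq> T" and x: "x \<in> T"
    by (cases xs) auto
  have lin2: "F z (zs[j := a *\<^sub>R u + b *\<^sub>R v]) = a * F z (zs[j := u]) + b * F z (zs[j := v])"
    if "length zs = q" "set zs \<subseteq> T" "j < q" for z zs j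
    using alternating_formsD(2)[OF F that] * by blast
  show "lap F (xs[i := a *\<^sub>R u + b *\<^sub>R v]) = a * lap F (xs[i := u]) + b * lap F (xs[i := v])"
  proof (cases i)
    case 0
    then show ?thesis
      using * ys by (simp add: Cons lin lin2 sum.distrib sum_distrib_left algebra_simps)
  next
    case (Suc j)
    define t where "t w c = F (ys[j := w] ! c) (ys[j := w, c := x])" for w c
    have "t (a *\<^sub>R u + b *\<^sub>R v) c = a * t u c + b * t v c" if c: "c < q" for c
    proof (cases "c = j")
      case True
      then show ?thesis using * Suc ys by (simp add: t_def lin)
    next
      case False
      have "set (ys[c := x]) \<subseteq> T" using ys x by (simp add: set_update_subsetI)
      then show ?thesis
        using False lin2[of "ys[c := x]" j] ys c * Suc by (simp add: t_def list_update_swap[of j c])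
    qed
    then have "(\<Sum>c<q. t (a *\<^sub>R u + b *\<^sub>R v) c) = a * (\<Sum>c<q. t u c) + b * (\<Sum>c<q. t v c)"
      by (simp add: sum.distrib sum_distrib_left)
    then show ?thesis
      using * Suc lin2[OF ys, of j x] by (simp add: Cons ys t_def algebra_simps)
  qed
next
  fix xs :: "'a list" and i j
  assume *: "length xs = Suc q \<and> set xs \<subseteq> T \<and> i < j \<and> j < Suc q \<and> xs ! i = xs ! j"
  then obtain x ys where Cons: "xs = x # ys" and ys: "length ys = q"
    by (cases xs) auto
  obtain l where l: "j = Suc l" "l < q" using * by (cases j) auto
  show "lap F xs = 0"
  proof (cases i)
    case 0
    have "F (ys ! b) (ys[b := x]) = (if b = l then F x ys else 0)" if "b < q" for b
      using alternating_forms_repeat'[OF F, of b l "ys[b := x]"] * 0 l that ys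
      by (auto simp: Cons)
    then show ?thesis using l by (simp add: Cons ys)
  next
    case (Suc m)
    have m: "m < q" "m \<noteq> l" "ys ! m = ys ! l" using * Suc l by (auto simp: Cons)
    have "F x ys = 0" using alternating_forms_repeat'[OF F m(2,1) l(2) m(3)] .
    moreover have "(\<Sum>b<q. F (ys ! b) (ys[b := x])) = (\<Sum>b\<in>{m, l}. F (ys ! b) (ys[b := x]))"
    proof (rule sum.mono_neutral_right)
      show "\<forall>b\<in>{..<q} - {m, l}. F (ys ! b) (ys[b := x]) = 0"
        using alternating_forms_repeat'[OF F m(2,1) l(2)] m by auto
    qed (use m l in auto)
    moreover have "F (ys ! m) (ys[m := x]) = - F (ys ! m) (ys[l := x])"
      using alternating_forms_swap[OF F T m(1) l(2) m(2), of "ys ! m" ys x "ys ! m"] m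
      by (metis list_update_id list_update_swap)
    ultimately show ?thesis using m by (simp add: Cons ys)
  qed
qed

lemma sum_fun_apply: "(\<Sum>a\<in>S. f a) x = (\<Sum>a\<in>S. f a x)"
  by (induction S rule: infinite_finite_induct) auto

text \<open>
  One expansion in each block of arguments; the two factors \<open>q!\<close> cancel the normalization of the
  product.
\<close>

lemma dform_prod_1_lap:
  assumes \<eta>: "\<eta> \<in> dform_space q T" and T: "subspace T"
  shows "dform_prod 1 q G \<eta> = (\<lambda>xs ys. lap (\<lambda>x xs. lap (\<lambda>y ys. G [x] [y] * \<eta> xs ys) ys) xs)"
proof (intro ext)
  fix xs ys :: "'a list"
  note s = alternating_forms_cmult
  show "dform_prod 1 q G \<eta> xs ys = lap (\<lambda>x xs. lap (\<lambda>y ys. G [x] [y] * \<eta> xs ys) ys) xs"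
  proof (cases "length xs = Suc q \<and> length ys = Suc q")
    case False
    then have "\<eta> (tl (xs[a := hd xs])) (tl (ys[b := hd ys])) = 0"
      if "a < length xs" "b < length ys" for a b
      using that by (intro dform_space_outside[OF \<eta>]) auto
    then show ?thesis
      using False by (auto simp: dform_prod_def lap_def simp del: upt_Suc)
  next
    case True
    let ?U = "{..<Suc q}" and ?m = "\<lambda>zs \<sigma>. map (\<lambda>i. zs ! \<sigma> i) [1..<Suc q]"
    define F where "F x xs = lap (\<lambda>y ys. G [x] [y] * \<eta> xs ys) ys" for x xs
    have F: "F x \<in> alternating_forms q T" for x
    proof -
      let ?c = "\<lambda>a. (if a = 0 then 1 else - 1) * G [x] [ys ! a]"
      have "F x = (\<Sum>a<length ys. (\<lambda>xs. ?c a * \<eta> xs (tl (ys[a := hd ys]))))"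
        by (simp add: F_def lap_def fun_eq_iff sum_fun_apply mult.assoc)
      moreover have "(\<lambda>xs. ?c a * \<eta> xs (tl (ys[a := hd ys]))) \<in> alternating_forms q T" for a
        using s[OF dform_spaceD(1)[OF \<eta>]] by blast
      ultimately show ?thesis by (simp add: subspace_sum[OF subspace_alternating_forms])
    qed
    have one: "[0..<Suc 0] = [0]" by simp
    have "dform_prod 1 q G \<eta> xs ys * (fact q)\<^sup>2
      = (\<Sum>\<sigma> | \<sigma> permutes ?U. of_int (sign \<sigma>) * (\<Sum>\<tau> | \<tau> permutes ?U. of_int (sign \<tau>) *
          (G [xs ! \<sigma> 0] [ys ! \<tau> 0] * \<eta> (?m xs \<sigma>) (?m ys \<tau>))))"
      using True by (simp add: dform_prod_def one sum_distrib_left mult.assoc del: upt_Suc)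
    also have "\<dots> = (\<Sum>\<sigma> | \<sigma> permutes ?U. of_int (sign \<sigma>) * (fact q * F (xs ! \<sigma> 0) (?m xs \<sigma>)))"
      unfolding F_def using True
      by (subst laplace_expansion[OF _ T]) (auto intro: s dform_spaceD[OF \<eta>])
    also have "\<dots> = fact q * (\<Sum>\<sigma> | \<sigma> permutes ?U. of_int (sign \<sigma>) * F (xs ! \<sigma> 0) (?m xs \<sigma>))"
      by (simp only: sum_distrib_left mult.left_commute)
    also have "\<dots> = (fact q)\<^sup>2 * lap F xs"
      using True by (subst laplace_expansion[OF F T]) (auto simp: power2_eq_square)
    finally show ?thesis by (simp add: F_def[abs_def])
  qed
qed

section \<open>The metric and the Ricci contraction on an inner product space\<close>

lemma sum_on_subspace:
  assumes T: "subspace T" and E: "finite E" "E \<subseteq> T"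
    and lin: "\<And>u v a b. u \<in> T \<Longrightarrow> v \<in> T \<Longrightarrow> f (a *\<^sub>R u + b *\<^sub>R v) = a * f u + b * (f v :: real)"
  shows "f (\<Sum>e\<in>E. c e *\<^sub>R e) = (\<Sum>e\<in>E. c e * f e)"
  using E
proof (induction E rule: finite_induct)
  case empty
  have "f (0 *\<^sub>R 0 + 0 *\<^sub>R 0) = 0" using lin[of 0 0 0 0] subspace_0[OF T] by simp
  then show ?case by simp
next
  case (insert e E)
  have "(\<Sum>e\<in>E. c e *\<^sub>R e) \<in> T"
    using insert by (intro subspace_sum[OF T]) (auto intro: subspace_scale[OF T])
  then show ?case
    using insert lin[of e "\<Sum>e\<in>E. c e *\<^sub>R e" "c e" 1] by simp
qed

text \<open>
  The situation in a single tangent space; the existence of an orthonormal basis expresses that the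
  metric is positive definite.
\<close>

locale inner_product_subspace =
  fixes G :: "'v::real_vector dform" and T :: "'v set" and n :: nat
  assumes metric: "G \<in> dform_space 1 T"
    and sym: "\<And>u v. u \<in> T \<Longrightarrow> v \<in> T \<Longrightarrow> G [u] [v] = G [v] [u]"
    and ex_basis: "\<exists>E. orthonormal_basis G T E"
    and dim: "dim T = n"
begin

definition basis :: "'v set" where
  "basis = (SOME E. orthonormal_basis G T E)"

lemma orthonormal: "orthonormal_basis G T basis"
  unfolding basis_def using ex_basis by (rule someI_ex)

lemma finite_basis: "finite basis" and basis_subset: "basis \<subseteq> T" and span_basis: "span basis = T"
  and metric_basis: "u \<in> basis \<Longrightarrow> v \<in> basis \<Longrightarrow> G [u] [v] = (if u = v then 1 else 0)"
  using orthonormal unfolding orthonormal_basis_def by auto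

lemma subspace_T: "subspace T"
  by (metis span_basis subspace_span)

lemma contraction_basis: "contraction G T \<omega> xs ys = (\<Sum>e\<in>basis. \<omega> (e # xs) (e # ys))"
  by (simp add: contraction_def basis_def)

lemma metric_linear_left:
  assumes "u \<in> T" "v \<in> T"
  shows "G [a *\<^sub>R u + b *\<^sub>R v] zs = a * G [u] zs + b * G [v] zs"
  using alternating_formsD(2)[OF dform_spaceD(1)[OF metric, of zs], of "[u]" 0 u v a b] assms by simp

lemma metric_linear_right:
  assumes "u \<in> T" "v \<in> T"
  shows "G zs [a *\<^sub>R u + b *\<^sub>R v] = a * G zs [u] + b * G zs [v]"
  using alternating_formsD(2)[OF dform_spaceD(2)[OF metric, of zs], of "[u]" 0 u v a b] assms by simp

lemma metric_outside: "u \<notin> T \<or> v \<notin> T \<Longrightarrow> G [u] [v] = 0"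
  using dform_space_outside[OF metric, of "[u]" "[v]"] by auto

lemma basis_expansion:
  assumes "y \<in> T"
  shows "y = (\<Sum>e\<in>basis. G [y] [e] *\<^sub>R e)"
proof -
  obtain c where c: "y = (\<Sum>e\<in>basis. c e *\<^sub>R e)"
    using assms span_finite[OF finite_basis] span_basis by auto
  have "G [y] [e] = c e" if "e \<in> basis" for e
  proof -
    have "G [y] [e] = (\<Sum>f\<in>basis. c f * G [f] [e])"
      unfolding c by (rule sum_on_subspace[OF subspace_T finite_basis basis_subset, where f = "\<lambda>v. G [v] [e]"])
        (rule metric_linear_left)
    also have "\<dots> = (\<Sum>f\<in>basis. if f = e then c f else 0)"
      using that by (intro sum.cong) (auto simp: metric_basis)
    finally show ?thesis using that finite_basis by simp
  qed
  then show ?thesis using c by simp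
qed

lemma sum_basis_metric:
  assumes lin: "\<And>u v a b. u \<in> T \<Longrightarrow> v \<in> T \<Longrightarrow> f (a *\<^sub>R u + b *\<^sub>R v) = a * f u + b * (f v :: real)"
    and y: "y \<in> T"
  shows "(\<Sum>e\<in>basis. G [y] [e] * f e) = f y" "(\<Sum>e\<in>basis. G [e] [y] * f e) = f y"
proof -
  show "(\<Sum>e\<in>basis. G [y] [e] * f e) = f y"
    using sum_on_subspace[OF subspace_T finite_basis basis_subset lin, of "\<lambda>e. G [y] [e]"]
      basis_expansion[OF y] by simp
  then show "(\<Sum>e\<in>basis. G [e] [y] * f e) = f y"
    using basis_subset y by (simp add: sym subset_iff cong: sum.cong)
qed

lemma card_basis: "card basis = n"
proof -
  have "independent basis"
  proof (rule independent_if_scalars_zero[OF finite_basis])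
    fix c e assume c: "(\<Sum>e\<in>basis. c e *\<^sub>R e) = 0" and e: "e \<in> basis"
    have "0 = G [0] [e]"
      using metric_linear_left[of 0 0 0 0 "[e]"] subspace_0[OF subspace_T] by simp
    also have "\<dots> = (\<Sum>f\<in>basis. c f * G [f] [e])"
      unfolding c[symmetric]
      by (rule sum_on_subspace[OF subspace_T finite_basis basis_subset, where f = "\<lambda>v. G [v] [e]"])
        (rule metric_linear_left)
    also have "\<dots> = (\<Sum>f\<in>basis. if f = e then c f else 0)"
      using e by (intro sum.cong) (auto simp: metric_basis)
    finally show "c e = 0" using e finite_basis by simp
  qed
  then show ?thesis
    using dim_eq_card[of basis T] span_basis dim by (metis span_span)
qed

lemma dform_prod_metric:
  assumes "\<eta> \<in> dform_space q T"
  shows "dform_prod 1 q G \<eta> \<in> dform_space (Suc q) T"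
proof -
  note L = dform_prod_1_lap[OF assms subspace_T]
  note s = alternating_forms_cmult
  show ?thesis
    unfolding dform_space_def mem_Collect_eq
  proof (intro conjI allI)
    fix ys
    have "lap (\<lambda>x xs. lap (\<lambda>y ys. G [x] [y] * \<eta> xs ys) ys) \<in> alternating_forms (Suc q) T"
    proof (rule lap_alternating[OF _ subspace_T])
      fix x
      let ?c = "\<lambda>a. (if a = 0 then 1 else - 1) * G [x] [ys ! a]"
      have "(\<lambda>xs. lap (\<lambda>y ys. G [x] [y] * \<eta> xs ys) ys)
          = (\<Sum>a<length ys. (\<lambda>xs. ?c a * \<eta> xs (tl (ys[a := hd ys]))))"
        by (simp add: lap_def fun_eq_iff sum_fun_apply mult.assoc)
      then show "(\<lambda>xs. lap (\<lambda>y ys. G [x] [y] * \<eta> xs ys) ys) \<in> alternating_forms q T"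
        using s[OF dform_spaceD(1)[OF assms]] by (simp add: subspace_sum[OF subspace_alternating_forms])
    next
      show "lap (\<lambda>y ys. G [a *\<^sub>R u + b *\<^sub>R v] [y] * \<eta> xs ys) ys
          = a * lap (\<lambda>y ys. G [u] [y] * \<eta> xs ys) ys + b * lap (\<lambda>y ys. G [v] [y] * \<eta> xs ys) ys"
        if "u \<in> T" "v \<in> T" for u v a b xs
        using that by (simp add: lap_def metric_linear_left sum_distrib_left algebra_simps flip: sum.distrib)
    qed (simp add: lap_def metric_outside)
    then show "(\<lambda>xs. dform_prod 1 q G \<eta> xs ys) \<in> alternating_forms (Suc q) T"
      by (simp only: L)
  next
    fix xs
    have t: "lap (\<lambda>y ys. G [x] [y] * \<eta> xs ys) \<in> alternating_forms (Suc q) T" for x xs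
    proof (rule lap_alternating[OF _ subspace_T])
      show "(\<lambda>ys. G [x] [y] * \<eta> xs ys) \<in> alternating_forms q T" for y
        using s[OF dform_spaceD(2)[OF assms]] by blast
    qed (simp_all add: metric_linear_right metric_outside algebra_simps)
    have "(\<lambda>ys. lap (\<lambda>x xs. lap (\<lambda>y ys. G [x] [y] * \<eta> xs ys) ys) xs)
        = (\<Sum>a<length xs. (if a = 0 then 1 else - 1) *\<^sub>R
            lap (\<lambda>y ys. G [xs ! a] [y] * \<eta> (tl (xs[a := hd xs])) ys))"
      by (rule ext) (simp add: sum_fun_apply scaleR_fun_def, subst lap_def, rule refl)
    moreover have "\<dots> \<in> alternating_forms (Suc q) T"
      by (intro subspace_sum[OF subspace_alternating_forms] subspace_scale[OF subspace_alternating_forms] t)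
    ultimately show "(\<lambda>ys. dform_prod 1 q G \<eta> xs ys) \<in> alternating_forms (Suc q) T"
      by (simp only: L)
  qed
qed

lemma contraction_in:
  assumes "\<eta> \<in> dform_space (Suc q) T"
  shows "contraction G T \<eta> \<in> dform_space q T"
  unfolding dform_space_def mem_Collect_eq
proof (intro conjI allI)
  fix ys
  have "(\<lambda>xs. contraction G T \<eta> xs ys) = (\<Sum>e\<in>basis. (\<lambda>xs. \<eta> (e # xs) (e # ys)))"
    by (simp add: contraction_basis fun_eq_iff sum_fun_apply)
  then show "(\<lambda>xs. contraction G T \<eta> xs ys) \<in> alternating_forms q T"
    using basis_subset dform_spaceD(1)[OF assms]
    by (auto intro!: subspace_sum[OF subspace_alternating_forms] alternating_forms_Cons[where \<alpha> = "\<lambda>xs. \<eta> xs _"])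
next
  fix xs
  have "(\<lambda>ys. contraction G T \<eta> xs ys) = (\<Sum>e\<in>basis. (\<lambda>ys. \<eta> (e # xs) (e # ys)))"
    by (simp add: contraction_basis fun_eq_iff sum_fun_apply)
  then show "(\<lambda>ys. contraction G T \<eta> xs ys) \<in> alternating_forms q T"
    using basis_subset dform_spaceD(2)[OF assms]
    by (auto intro!: subspace_sum[OF subspace_alternating_forms] alternating_forms_Cons)
qed

lemma contraction_dform_space_0:
  assumes "\<eta> \<in> dform_space 0 T"
  shows "contraction G T \<eta> = 0"
  using dform_space_outside[OF assms] by (auto simp: contraction_basis fun_eq_iff)

text \<open>
  Brings the summation vector of a contraction to the first position, with the sign and the list
  that occur in \<open>lap\<close>.
\<close>

lemma alternating_forms_to_front:
  assumes \<alpha>: "\<alpha> \<in> alternating_forms q T" and a: "a < q" "length xs = q"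
  shows "\<alpha> (xs[a := e]) = (if a = 0 then 1 else -1) * \<alpha> (e # tl (xs[a := hd xs]))"
proof (cases xs)
  case (Cons x ys)
  show ?thesis
  proof (cases a)
    case (Suc b)
    then show ?thesis
      using alternating_forms_swap[OF \<alpha> subspace_T, of 0 "Suc b" xs x e] a by (simp add: Cons)
  qed (simp add: Cons)
qed (use a in simp)

text \<open>
  The \<open>sl\<^sub>2\<close> relation.  Expand \<open>(g \<eta>) (e # xs) (e # ys)\<close> in both blocks and sum over the
  orthonormal basis.  The term that takes \<open>e\<close> out of both blocks gives \<open>n \<eta>\<close>; the terms that
  take it out of only one block give \<open>- q \<eta>\<close> for each block, since the sum over \<open>e\<close> puts the removed
  vector back to its place; the others are the expansion of \<open>g (c \<eta>)\<close>.  For \<open>q = 0\<close> the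
  last summand, with \<open>q - 1 = 0\<close>, is a product with \<open>0\<close>.
\<close>

lemma contraction_dform_prod_metric:
  assumes \<eta>: "\<eta> \<in> dform_space q T"
  shows "contraction G T (dform_prod 1 q G \<eta>)
    = (real n - 2 * real q) *\<^sub>R \<eta> + dform_prod 1 (q - 1) G (contraction G T \<eta>)" (is "?c = ?r")
proof -
  have c: "?c \<in> dform_space q T"
    by (intro contraction_in dform_prod_metric \<eta>)
  have k: "contraction G T \<eta> \<in> dform_space (q - 1) T"
    using \<eta> contraction_in contraction_dform_space_0 subspace_0[OF subspace_dform_space] by (cases q) auto
  have "dform_prod 1 (q - 1) G (contraction G T \<eta>) \<in> dform_space q T"
  proof (cases q)
    case 0
    then show ?thesis
      using \<eta> contraction_dform_space_0 subspace_0[OF subspace_dform_space]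
      by (simp add: linear_0[OF linear_dform_prod])
  qed (use dform_prod_metric[OF k] in simp)
  then have r: "?r \<in> dform_space q T"
    by (intro subspace_add[OF subspace_dform_space] subspace_scale[OF subspace_dform_space] \<eta>)
  show ?thesis
  proof (intro ext)
    fix xs ys
    show "?c xs ys = ?r xs ys"
    proof (cases "(length xs = q \<and> set xs \<subseteq> T) \<and> (length ys = q \<and> set ys \<subseteq> T)")
      case False
      then have *: "\<not> (length xs = q \<and> set xs \<subseteq> T) \<or> \<not> (length ys = q \<and> set ys \<subseteq> T)" by blast
      show ?thesis by (simp only: dform_space_outside[OF c *] dform_space_outside[OF r *])
    next
      case True
      then have lx: "length xs = q" and ly: "length ys = q" by auto
      have nx: "xs ! a \<in> T" if "a < q" for a
        using True that by (auto intro: subsetD[OF _ nth_mem])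
      have ny: "ys ! b \<in> T" if "b < q" for b
        using True that by (auto intro: subsetD[OF _ nth_mem])
      have sx: "\<eta> (xs[a := e]) zs = (if a = 0 then 1 else -1) * \<eta> (e # tl (xs[a := hd xs])) zs"
        if "a < q" for a e zs
        using alternating_forms_to_front[OF dform_spaceD(1)[OF \<eta>] that lx] .
      have sy: "\<eta> zs (ys[b := e]) = (if b = 0 then 1 else -1) * \<eta> zs (e # tl (ys[b := hd ys]))"
        if "b < q" for b e zs
        using alternating_forms_to_front[OF dform_spaceD(2)[OF \<eta>] that ly] .
      have A: "(\<Sum>e\<in>basis. G [e] [e] * \<eta> xs ys) = real n * \<eta> xs ys"
        using card_basis by (simp add: metric_basis)
      have B: "(\<Sum>e\<in>basis. \<Sum>b<q. G [e] [ys ! b] * \<eta> xs (ys[b := e])) = real q * \<eta> xs ys"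
      proof -
        have "(\<Sum>e\<in>basis. G [e] [ys ! b] * \<eta> xs (ys[b := e])) = \<eta> xs (ys[b := ys ! b])" if "b < q" for b
          by (intro sum_basis_metric(2)[where f = "\<lambda>e. \<eta> xs (ys[b := e])"] ny
              alternating_formsD(2)[OF dform_spaceD(2)[OF \<eta>]]) (use True that in auto)
        then show ?thesis by (subst sum.swap) simp
      qed
      have C: "(\<Sum>e\<in>basis. \<Sum>a<q. G [xs ! a] [e] * \<eta> (xs[a := e]) ys) = real q * \<eta> xs ys"
      proof -
        have "(\<Sum>e\<in>basis. G [xs ! a] [e] * \<eta> (xs[a := e]) ys) = \<eta> (xs[a := xs ! a]) ys" if "a < q" for a
          by (intro sum_basis_metric(1)[where f = "\<lambda>e. \<eta> (xs[a := e]) ys"] nx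
              alternating_formsD(2)[OF dform_spaceD(1)[OF \<eta>]]) (use True that in auto)
        then show ?thesis by (subst sum.swap) simp
      qed
      have D: "(\<Sum>e\<in>basis. \<Sum>a<q. \<Sum>b<q. G [xs ! a] [ys ! b] * \<eta> (xs[a := e]) (ys[b := e]))
          = dform_prod 1 (q - 1) G (contraction G T \<eta>) xs ys"
      proof -
        let ?s = "\<lambda>a. if a = (0::nat) then 1 else (-1::real)"
        have "(\<Sum>e\<in>basis. \<Sum>a<q. \<Sum>b<q. G [xs ! a] [ys ! b] * \<eta> (xs[a := e]) (ys[b := e]))
          = (\<Sum>a<q. \<Sum>b<q. \<Sum>e\<in>basis. G [xs ! a] [ys ! b] * \<eta> (xs[a := e]) (ys[b := e]))"
          by (subst sum.swap) (intro sum.cong refl sum.swap)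
        also have "\<dots> = (\<Sum>a<q. \<Sum>b<q. ?s a * (?s b * (G [xs ! a] [ys ! b] *
            contraction G T \<eta> (tl (xs[a := hd xs])) (tl (ys[b := hd ys])))))"
          by (intro sum.cong refl) (simp add: sx sy contraction_basis sum_distrib_left)
        also have "\<dots> = dform_prod 1 (q - 1) G (contraction G T \<eta>) xs ys"
          unfolding dform_prod_1_lap[OF k subspace_T] lap_def lx ly sum_distrib_left ..
        finally show ?thesis .
      qed
      have "?c xs ys = (\<Sum>e\<in>basis. (G [e] [e] * \<eta> xs ys - (\<Sum>b<q. G [e] [ys ! b] * \<eta> xs (ys[b := e])))
          - (\<Sum>a<q. G [xs ! a] [e] * \<eta> (xs[a := e]) ys
              - (\<Sum>b<q. G [xs ! a] [ys ! b] * \<eta> (xs[a := e]) (ys[b := e]))))"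
        unfolding contraction_basis dform_prod_1_lap[OF \<eta> subspace_T] lap_Cons lx ly ..
      also have "\<dots> = real n * \<eta> xs ys - real q * \<eta> xs ys
          - (real q * \<eta> xs ys - dform_prod 1 (q - 1) G (contraction G T \<eta>) xs ys)"
        unfolding sum_subtractf A B C D ..
      also have "\<dots> = (real n - 2 * real q) * \<eta> xs ys + dform_prod 1 (q - 1) G (contraction G T \<eta>) xs ys"
        by (simp only: ring_distribs)
      finally show ?thesis by (simp add: scaleR_fun_def)
    qed
  qed
qed

text \<open>
  By multilinearity the entries may be taken from a basis, where there are repetitions if
  \<open>q > n\<close>.  The induction moves a boundary \<open>i\<close>, after which the entries are basis vectors already.
\<close>

lemma alternating_forms_eq_0:
  assumes \<alpha>: "\<alpha> \<in> alternating_forms q T" and q: "n < q"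
  shows "\<alpha> xs = 0"
proof (cases "length xs = q \<and> set xs \<subseteq> T")
  case True
  have "\<alpha> xs = 0" if "length xs = q" "set xs \<subseteq> T" "i \<le> q" "set (drop i xs) \<subseteq> basis" for i xs
    using that
  proof (induction i arbitrary: xs)
    case 0
    have "\<not> distinct xs"
    proof
      assume "distinct xs"
      then have "q = card (set xs)" using 0 by (simp add: distinct_card)
      also have "\<dots> \<le> card basis" using 0 by (intro card_mono finite_basis) auto
      finally show False using q card_basis by simp
    qed
    then obtain i j where "i < q" "j < q" "i \<noteq> j" "xs ! i = xs ! j"
      using 0 by (auto simp: distinct_conv_nth)
    then show ?case using alternating_forms_repeat'[OF \<alpha>] by blast
  next
    case (Suc i)
    have i: "i < q" "xs ! i \<in> T" using Suc.prems by auto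
    have "\<alpha> xs = \<alpha> (xs[i := (\<Sum>e\<in>basis. G [xs ! i] [e] *\<^sub>R e)])"
      using basis_expansion[OF i(2)] by simp
    also have "\<dots> = (\<Sum>e\<in>basis. G [xs ! i] [e] * \<alpha> (xs[i := e]))"
      using alternating_formsD(2)[OF \<alpha>] Suc.prems i
      by (intro sum_on_subspace[OF subspace_T finite_basis basis_subset, where f = "\<lambda>e. \<alpha> (xs[i := e])"]) auto
    also have "\<dots> = 0"
    proof (intro sum.neutral ballI)
      fix e assume e: "e \<in> basis"
      have "drop i (xs[i := e]) = e # drop (Suc i) xs"
        using i Suc.prems by (metis Cons_nth_drop_Suc drop_update_cancel length_list_update lessI nth_list_update_eq)
      moreover have "set (xs[i := e]) \<subseteq> T"
        using Suc.prems e basis_subset by (intro set_update_subsetI) auto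
      ultimately have "\<alpha> (xs[i := e]) = 0"
        using Suc.prems e by (intro Suc.IH) auto
      then show "G [xs ! i] [e] * \<alpha> (xs[i := e]) = 0" by simp
    qed
    finally show ?case .
  qed
  from this[of xs q] show ?thesis using True by simp
qed (use alternating_formsD(1)[OF \<alpha>] in blast)

lemma dform_space_eq_0:
  assumes "\<omega> \<in> dform_space q T" "n < q"
  shows "\<omega> = 0"
  using alternating_forms_eq_0[OF dform_spaceD(2)[OF assms(1)] assms(2)] by (simp add: fun_eq_iff)

end

section \<open>Powers of the metric on trace free double forms\<close>

text \<open>
  Only nonzero eigenvectors must have distinct eigenvalues.  This form is needed since the
  eigenvalues below may coincide for components that vanish.
\<close>

lemma eigenvectors_sum_eq_0:
  fixes v :: "'i \<Rightarrow> 'b::real_vector"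
  assumes A: "linear A" and I: "finite I"
    and eig: "\<And>i. i \<in> I \<Longrightarrow> A (v i) = \<mu> i *\<^sub>R v i"
    and inj: "\<And>i j. i \<in> I \<Longrightarrow> j \<in> I \<Longrightarrow> v i \<noteq> 0 \<Longrightarrow> v j \<noteq> 0 \<Longrightarrow> \<mu> i = \<mu> j \<Longrightarrow> i = j"
    and sum: "(\<Sum>i\<in>I. v i) = 0"
    and i: "i \<in> I"
  shows "v i = 0"
  using I eig inj sum i
proof (induction I arbitrary: v i rule: finite_induct)
  case (insert j I)
  have tot: "v j + (\<Sum>i\<in>I. v i) = 0" using insert by simp
  \<comment> \<open>\<open>A\<close> minus its eigenvalue at \<open>j\<close> removes the summand \<open>v j\<close>\<close>
  have "(\<Sum>i\<in>I. (\<mu> i - \<mu> j) *\<^sub>R v i) = 0"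
  proof -
    have "0 = A (v j + (\<Sum>i\<in>I. v i))" by (simp add: tot linear_0[OF A])
    also have "\<dots> = \<mu> j *\<^sub>R v j + (\<Sum>i\<in>I. \<mu> i *\<^sub>R v i)"
      using insert.prems(1) by (simp add: linear_add[OF A] linear_sum[OF A])
    finally have "0 = \<mu> j *\<^sub>R v j + (\<Sum>i\<in>I. \<mu> i *\<^sub>R v i) - \<mu> j *\<^sub>R (v j + (\<Sum>i\<in>I. v i))"
      by (simp add: tot)
    then show ?thesis
      by (simp add: scaleR_diff_left sum_subtractf scaleR_add_right scaleR_sum_right)
  qed
  then have I0: "(\<mu> i - \<mu> j) *\<^sub>R v i = 0" if "i \<in> I" for i
    using insert.prems(1,2) that
    by (intro insert.IH[where v = "\<lambda>i. (\<mu> i - \<mu> j) *\<^sub>R v i"])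
      (auto simp: linear_scale[OF A] mult.commute)
  have j0: "v j = 0"
  proof (rule ccontr)
    assume "v j \<noteq> 0"
    then have "v i = 0" if "i \<in> I" for i
      using I0[OF that] insert.prems(2)[of i j] insert.hyps that by auto
    with tot \<open>v j \<noteq> 0\<close> show False by simp
  qed
  show ?case
  proof (cases "i = j")
    case False
    then show ?thesis
      using insert.IH[of v i] insert.prems tot j0 by auto
  qed (simp add: j0)
qed simp

text \<open>
  The factor by which \<open>c\<^sup>k\<close> takes \<open>g\<^sup>i \<omega>\<close> to \<open>g\<^sup>i\<^sup>-\<^sup>k \<omega>\<close> for a trace free \<open>\<omega>\<close> of order \<open>r\<close>.
  It is formed in the reals because \<open>n - 2 r - i + j + 1\<close> may be negative.
\<close>

definition contraction_coeff :: "nat \<Rightarrow> nat \<Rightarrow> nat \<Rightarrow> nat \<Rightarrow> real" where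
  "contraction_coeff n r i k =
     (\<Prod>j<k. (real i - real j) * (real n - 2 * real r - real i + real j + 1))"

context inner_product_subspace
begin

abbreviation tr :: "'v dform \<Rightarrow> 'v dform" where "tr \<equiv> contraction G T"
abbreviation gpow :: "nat \<Rightarrow> nat \<Rightarrow> 'v dform \<Rightarrow> 'v dform" where
  "gpow r i \<omega> \<equiv> dform_prod i r (dform_pow G i) \<omega>"

lemma gpow_0: "\<omega> \<in> dform_space r T \<Longrightarrow> gpow r 0 \<omega> = \<omega>"
  by (simp add: dform_prod_one subspace_T)

lemma gpow_Suc: "gpow r (Suc i) \<omega> = dform_prod 1 (i + r) G (gpow r i \<omega>)"
  using dform_prod_assoc[of 1 i r G "dform_pow G i" \<omega>] by simp

lemma gpow_add: "gpow r i \<omega> = 0 \<Longrightarrow> gpow r (i + k) \<omega> = 0"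
proof (induction k)
  case (Suc k)
  show ?case
    unfolding add_Suc_right gpow_Suc Suc.IH[OF Suc.prems] by (rule linear_0[OF linear_dform_prod])
qed simp

lemma gpow_in: "\<omega> \<in> dform_space r T \<Longrightarrow> gpow r i \<omega> \<in> dform_space (i + r) T"
proof (induction i)
  case (Suc i)
  then show ?case using dform_prod_metric[of "gpow r i \<omega>" "i + r"] by (simp only: gpow_Suc add_Suc)
qed (simp add: dform_prod_one subspace_T)

lemma gpow_one: "gpow 0 i dform_one = dform_pow G i"
proof (induction i)
  case (Suc i)
  then show ?case using gpow_Suc[of i 0 dform_one] by simp
qed (simp add: dform_prod_one[OF dform_one_in subspace_T])

lemma gpow_order_0:
  assumes "\<omega> \<in> dform_space 0 T"
  shows "gpow 0 i \<omega> = \<omega> [] [] *\<^sub>R dform_pow G i"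
  by (subst dform_space_0[OF assms]) (simp add: linear_scale[OF linear_dform_prod] gpow_one)

text \<open>
  In the induction, the commutation relation adds \<open>n - 2 (i + r)\<close> to the factor for \<open>g\<^sup>i \<omega>\<close>.
\<close>

lemma contraction_gpow:
  assumes "\<omega> \<in> trace_free_space G r T"
  shows "tr (gpow r (Suc i) \<omega>) = ((real i + 1) * (real n - 2 * real r - real i)) *\<^sub>R gpow r i \<omega>"
proof (induction i)
  case 0
  have \<omega>: "\<omega> \<in> dform_space r T" "tr \<omega> = 0" using assms by (auto simp: trace_free_space_def)
  have "tr (gpow r (Suc 0) \<omega>) = tr (dform_prod 1 r G \<omega>)"
    by (simp only: gpow_Suc gpow_0[OF \<omega>(1)] add_0)
  also have "\<dots> = (real n - 2 * real r) *\<^sub>R \<omega>"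
    unfolding contraction_dform_prod_metric[OF \<omega>(1)] \<omega>(2) linear_0[OF linear_dform_prod] by simp
  finally show ?case by (simp only: gpow_0[OF \<omega>(1)]) simp
next
  case (Suc i)
  have \<omega>: "\<omega> \<in> dform_space r T" using assms by (auto simp: trace_free_space_def)
  let ?a = "(real i + 1) * (real n - 2 * real r - real i)"
  have "tr (gpow r (Suc (Suc i)) \<omega>) = tr (dform_prod 1 (Suc i + r) G (gpow r (Suc i) \<omega>))"
    by (simp only: gpow_Suc[of "Suc i"])
  also have "\<dots> = (real n - 2 * real (Suc i + r)) *\<^sub>R gpow r (Suc i) \<omega>
      + dform_prod 1 (i + r) G (tr (gpow r (Suc i) \<omega>))"
    using contraction_dform_prod_metric[OF gpow_in[OF \<omega>, of "Suc i"]] by (simp only: add_Suc diff_Suc_1)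
  also have "\<dots> = (real n - 2 * real (Suc i + r)) *\<^sub>R gpow r (Suc i) \<omega> + ?a *\<^sub>R gpow r (Suc i) \<omega>"
    unfolding Suc.IH linear_scale[OF linear_dform_prod] by (simp only: gpow_Suc[of i])
  also have "\<dots> = ((real n - 2 * real (Suc i + r)) + ?a) *\<^sub>R gpow r (Suc i) \<omega>"
    by (simp only: scaleR_add_left)
  also have "(real n - 2 * real (Suc i + r)) + ?a
      = (real (Suc i) + 1) * (real n - 2 * real r - real (Suc i))"
    by (simp add: algebra_simps)
  finally show ?case .
qed

text \<open>
  If \<open>i + 2 r > n\<close>, the factors by which \<open>c\<close> takes \<open>g\<^sup>m\<^sup>+\<^sup>1 \<omega>\<close> to \<open>g\<^sup>m \<omega>\<close> are nonzero for all
  \<open>m \<ge> i\<close>, so \<open>g\<^sup>i \<omega> \<noteq> 0\<close> would propagate to all higher powers, and hence to orders above \<open>n\<close>.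
  In particular there are no nonzero trace free forms of order \<open>r\<close> with \<open>2 r > n\<close>.
\<close>

lemma gpow_nonzero_bound:
  assumes \<omega>: "\<omega> \<in> trace_free_space G r T" and nz: "gpow r i \<omega> \<noteq> 0"
  shows "i + 2 * r \<le> n"
proof (rule ccontr)
  assume i: "\<not> i + 2 * r \<le> n"
  have "gpow r (i + m) \<omega> \<noteq> 0" for m
  proof (induction m)
    case (Suc m)
    have "real n - 2 * real r - real (i + m) < 0"
      using i by linarith
    then have "(real (i + m) + 1) * (real n - 2 * real r - real (i + m)) \<noteq> 0"
      by (simp add: less_imp_neq)
    then have *: "tr (gpow r (Suc (i + m)) \<omega>) \<noteq> 0"
      unfolding contraction_gpow[OF \<omega>] scaleR_eq_0_iff using Suc by blast
    show ?case
    proof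
      assume "gpow r (i + Suc m) \<omega> = 0"
      then have "tr (gpow r (Suc (i + m)) \<omega>) = tr 0" by (simp only: add_Suc_right)
      with * show False by (simp only: linear_0[OF linear_contraction])
    qed
  next
    case 0
    show ?case unfolding add_0_right by (rule nz)
  qed
  moreover have "gpow r (i + n) \<omega> = 0"
    using \<omega> i dform_space_eq_0[OF gpow_in, of \<omega> r "i + n"] 
    by (cases "i + r = 0") (auto simp: trace_free_space_def)
  ultimately show False by blast
qed

abbreviation coeff :: "nat \<Rightarrow> nat \<Rightarrow> nat \<Rightarrow> real" where "coeff \<equiv> contraction_coeff n"

lemma funpow_contraction_gpow:
  assumes "\<omega> \<in> trace_free_space G r T" "k \<le> i"
  shows "(tr ^^ k) (gpow r i \<omega>) = coeff r i k *\<^sub>R gpow r (i - k) \<omega>"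
  using assms(2)
proof (induction k)
  case (Suc k)
  define m where "m = i - Suc k"
  have m: "i - k = Suc m" "real m = real i - real k - 1" using Suc.prems by (auto simp: m_def)
  have "(tr ^^ Suc k) (gpow r i \<omega>) = coeff r i k *\<^sub>R tr (gpow r (Suc m) \<omega>)"
    using Suc m by (simp add: linear_scale[OF linear_contraction])
  also have "\<dots> = (coeff r i k * ((real m + 1) * (real n - 2 * real r - real m))) *\<^sub>R gpow r m \<omega>"
    unfolding contraction_gpow[OF assms(1)] by simp
  also have "coeff r i k * ((real m + 1) * (real n - 2 * real r - real m)) = coeff r i (Suc k)"
    by (simp add: contraction_coeff_def m algebra_simps)
  finally show ?case by (simp only: m_def)
qed (simp add: contraction_coeff_def)

lemma funpow_contraction_gpow_0:
  assumes \<omega>: "\<omega> \<in> trace_free_space G r T" and k: "i < k"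
  shows "(tr ^^ k) (gpow r i \<omega>) = 0"
proof -
  have "tr \<omega> = 0" and o: "\<omega> \<in> dform_space r T" using \<omega> by (auto simp: trace_free_space_def)
  then have *: "(tr ^^ Suc i) (gpow r i \<omega>) = 0"
    using funpow_contraction_gpow[OF \<omega> order.refl]
    by (simp add: linear_scale[OF linear_contraction] dform_prod_one[OF o subspace_T])
  have "k = (k - Suc i) + Suc i" using k by simp
  then have "(tr ^^ k) (gpow r i \<omega>) = (tr ^^ (k - Suc i)) ((tr ^^ Suc i) (gpow r i \<omega>))"
    by (metis funpow_add o_apply)
  then show ?thesis by (simp only: * contraction_funpow_zero)
qed

lemma coeff_nonzero:
  assumes "k \<le> i" "i + 2 * r \<le> n"
  shows "coeff r i k \<noteq> 0"
proof -
  have "(real i - real j) * (real n - 2 * real r - real i + real j + 1) \<noteq> 0" if "j < k" for j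
  proof -
    have "real i - real j > 0" "real n - 2 * real r - real i + real j + 1 > 0"
      using assms that by linarith+
    then show ?thesis by simp
  qed
  then show ?thesis by (auto simp: contraction_coeff_def prod_zero_iff)
qed

text \<open>
  The summands are eigenvectors of \<open>\<eta> \<mapsto> c (g \<eta>)\<close>.  The difference of the eigenvalues for \<open>s\<close> and
  \<open>t\<close> is \<open>(s - t) (s + t - (n + 1))\<close>, and a nonzero component of order \<open>s\<close> satisfies
  \<open>q + s \<le> n\<close>; with \<open>t \<le> q\<close> this excludes \<open>s + t = n + 1\<close>.
\<close>

lemma gpow_sum_direct:
  assumes \<eta>: "\<And>r. r \<le> q \<Longrightarrow> \<eta> r \<in> trace_free_space G r T"
    and sum: "(\<Sum>r\<le>q. gpow r (q - r) (\<eta> r)) = 0" and r: "r \<le> q"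
  shows "gpow r (q - r) (\<eta> r) = 0"
proof -
  define A where "A = tr \<circ> dform_prod 1 q G"
  \<comment> \<open>the factor in \<open>contraction_gpow\<close> for the power \<open>q - r + 1\<close> of the metric\<close>
  define \<mu> where "\<mu> r = (real q - real r + 1) * (real n - real q - real r)" for r
  have A: "linear A"
    unfolding A_def by (intro linear_compose linear_dform_prod linear_contraction)
  show ?thesis
  proof (rule eigenvectors_sum_eq_0[OF A finite_atMost, of q "\<lambda>r. gpow r (q - r) (\<eta> r)" \<mu>])
    fix s assume "s \<in> {..q}"
    then have s: "s \<le> q" "q - s + s = q" by auto
    have "A (gpow s (q - s) (\<eta> s)) = tr (gpow s (Suc (q - s)) (\<eta> s))"
      unfolding A_def gpow_Suc s(2) by simp
    also have "\<dots> = \<mu> s *\<^sub>R gpow s (q - s) (\<eta> s)"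
      unfolding contraction_gpow[OF \<eta>[OF s(1)]] using s by (simp add: \<mu>_def of_nat_diff algebra_simps)
    finally show "A (gpow s (q - s) (\<eta> s)) = \<mu> s *\<^sub>R gpow s (q - s) (\<eta> s)" .
  next
    fix s t
    assume st: "s \<in> {..q}" "t \<in> {..q}" and nz: "gpow s (q - s) (\<eta> s) \<noteq> 0" "gpow t (q - t) (\<eta> t) \<noteq> 0"
      and eq: "\<mu> s = \<mu> t"
    have "q - s + 2 * s \<le> n" "q - t + 2 * t \<le> n"
      using gpow_nonzero_bound[OF \<eta> nz(1)] gpow_nonzero_bound[OF \<eta> nz(2)] st by auto
    then have "real s + real t \<noteq> real n + 1" using st by auto
    moreover have "(real s - real t) * (real s + real t - (real n + 1)) = 0"
      using eq by (simp add: \<mu>_def algebra_simps)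
    ultimately show "s = t" by simp
  qed (use sum r in auto)
qed

proposition contraction_power_decomposition:
  assumes \<eta>: "\<And>r. r \<le> p \<Longrightarrow> \<eta> r \<in> trace_free_space G r T" and k: "k \<le> p"
    and \<omega>: "\<omega> = (\<Sum>i\<le>p. dform_prod i (p - i) (dform_pow G i) (\<eta> (p - i)))"
  shows "(tr ^^ k) \<omega> = (\<Sum>r\<le>p - k. coeff r (p - r) k *\<^sub>R gpow r (p - k - r) (\<eta> r))"
proof -
  have lin: "linear (tr ^^ k)" for k
    by (induction k) (simp_all only: funpow.simps linear_id linear_compose[OF _ linear_contraction])
  have "\<omega> = (\<Sum>r\<le>p. gpow r (p - r) (\<eta> r))"
    unfolding \<omega> by (rule sum.reindex_bij_witness[where i = "\<lambda>r. p - r" and j = "\<lambda>i. p - i"]) auto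
  then have "(tr ^^ k) \<omega> = (\<Sum>r\<le>p. (tr ^^ k) (gpow r (p - r) (\<eta> r)))"
    by (simp add: linear_sum[OF lin])
  also have "\<dots> = (\<Sum>r\<le>p - k. (tr ^^ k) (gpow r (p - r) (\<eta> r)))"
    using k funpow_contraction_gpow_0[OF \<eta>] by (intro sum.mono_neutral_right) auto
  also have "\<dots> = (\<Sum>r\<le>p - k. coeff r (p - r) k *\<^sub>R gpow r (p - k - r) (\<eta> r))"
  proof (intro sum.cong refl)
    fix r assume "r \<in> {..p - k}"
    then have "r \<le> p" "k \<le> p - r" "p - r - k = p - k - r" using k by auto
    then show "(tr ^^ k) (gpow r (p - r) (\<eta> r)) = coeff r (p - r) k *\<^sub>R gpow r (p - k - r) (\<eta> r)"
      using funpow_contraction_gpow[OF \<eta>, of r k "p - r"] by simp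
  qed
  finally show ?thesis .
qed

proposition contraction_power_eq_if:
  assumes \<eta>: "\<And>r. r \<le> p \<Longrightarrow> \<eta> r \<in> trace_free_space G r T" and k: "k \<le> p"
    and \<omega>: "\<omega> = (\<Sum>i\<le>p. dform_prod i (p - i) (dform_pow G i) (\<eta> (p - i)))"
    and zero: "\<And>r. 1 \<le> r \<Longrightarrow> r \<le> p - k \<Longrightarrow> gpow r (p - r) (\<eta> r) = 0"
  shows "(tr ^^ k) \<omega> = (coeff 0 p k * \<eta> 0 [] []) *\<^sub>R dform_pow G (p - k)"
proof -
  have "coeff r (p - r) k *\<^sub>R gpow r (p - k - r) (\<eta> r) = 0" if r: "1 \<le> r" "r \<le> p - k" for r
  proof -
    have le: "r \<le> p" "k \<le> p - r" "p - r - k = p - k - r" using k r by auto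
    show ?thesis
      using funpow_contraction_gpow[OF \<eta>[OF le(1)] le(2)]
      unfolding zero[OF r] contraction_funpow_zero le(3) by simp
  qed
  then have "(\<Sum>r\<le>p - k. coeff r (p - r) k *\<^sub>R gpow r (p - k - r) (\<eta> r))
    = (\<Sum>r\<in>{0}. coeff r (p - r) k *\<^sub>R gpow r (p - k - r) (\<eta> r))"
    by (intro sum.mono_neutral_right) auto
  moreover
  have decomposition: "(tr ^^ k) \<omega> = (\<Sum>r\<le>p - k. coeff r (p - r) k *\<^sub>R gpow r (p - k - r) (\<eta> r))"
    by (rule contraction_power_decomposition[OF _ k \<omega>]) (rule \<eta>)
  moreover have "\<eta> 0 \<in> dform_space 0 T" using \<eta>[of 0] by (simp add: trace_free_space_def)
  ultimately show ?thesis
    by (simp add: gpow_order_0)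
qed

text \<open>
  The multiple of \<open>g\<^sup>p\<^sup>-\<^sup>k\<close> belongs to the summand of order \<open>0\<close>, so directness of the sum gives
  \<open>contraction_coeff n r (p - r) k\<close> times \<open>g\<^sup>p\<^sup>-\<^sup>k\<^sup>-\<^sup>r \<eta>\<^sub>r\<close> equal to \<open>0\<close> for \<open>r \<ge> 1\<close>.  Either that
  coefficient is nonzero, and multiplying by \<open>g\<^sup>k\<close> yields the claim, or \<open>g\<^sup>p\<^sup>-\<^sup>r \<eta>\<^sub>r\<close> vanishes anyway.
\<close>

proposition contraction_power_eq_only_if:
  assumes \<eta>: "\<And>r. r \<le> p \<Longrightarrow> \<eta> r \<in> trace_free_space G r T" and k: "k \<le> p"
    and \<omega>: "\<omega> = (\<Sum>i\<le>p. dform_prod i (p - i) (dform_pow G i) (\<eta> (p - i)))"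
    and proportional: "(tr ^^ k) \<omega> = lam *\<^sub>R dform_pow G (p - k)"
    and r: "1 \<le> r" "r \<le> p - k"
  shows "gpow r (p - r) (\<eta> r) = 0"
proof -
  have decomposition: "(tr ^^ k) \<omega> = (\<Sum>r\<le>p - k. coeff r (p - r) k *\<^sub>R gpow r (p - k - r) (\<eta> r))"
    by (rule contraction_power_decomposition[OF _ k \<omega>]) (rule \<eta>)
  \<comment> \<open>the components of the difference of the two sides\<close>
  define \<theta> where "\<theta> s = coeff s (p - s) k *\<^sub>R \<eta> s - (if s = 0 then lam *\<^sub>R dform_one else 0)" for s
  have sub: "subspace (trace_free_space G s T)" for s
    unfolding trace_free_space_def
    using subspace_dform_space[of s T] linear_contraction[of G T]
    by (auto simp: subspace_def linear_add linear_scale linear_0)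
  have one: "dform_one \<in> trace_free_space G 0 T"
    using dform_one_in contraction_dform_space_0 by (auto simp: trace_free_space_def)
  have "gpow r (p - k - r) (\<theta> r) = 0"
  proof (rule gpow_sum_direct)
    show "\<theta> s \<in> trace_free_space G s T" if "s \<le> p - k" for s
      using that one \<eta>[of s] unfolding \<theta>_def
      by (auto intro!: subspace_diff[OF sub] subspace_scale[OF sub] subspace_0[OF sub])
    have "gpow s (p - k - s) (\<theta> s) = coeff s (p - s) k *\<^sub>R gpow s (p - k - s) (\<eta> s)
        - (if s = 0 then lam *\<^sub>R dform_pow G (p - k) else 0)" for s
      by (simp add: \<theta>_def linear_diff[OF linear_dform_prod] linear_scale[OF linear_dform_prod] gpow_one
          linear_0[OF linear_dform_prod])
    then have "(\<Sum>s\<le>p - k. gpow s (p - k - s) (\<theta> s)) = (tr ^^ k) \<omega> - lam *\<^sub>R dform_pow G (p - k)"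
      unfolding decomposition by (simp add: sum_subtractf)
    then show "(\<Sum>s\<le>p - k. gpow s (p - k - s) (\<theta> s)) = 0"
      by (simp add: proportional)
  qed (use r in simp)
  then have *: "coeff r (p - r) k *\<^sub>R gpow r (p - k - r) (\<eta> r) = 0"
    using r by (simp add: \<theta>_def linear_scale[OF linear_dform_prod])
  show ?thesis
  proof (rule ccontr)
    assume nz: "gpow r (p - r) (\<eta> r) \<noteq> 0"
    have "p - r + 2 * r \<le> n" using gpow_nonzero_bound[OF \<eta> nz] r by simp
    moreover have "k \<le> p - r" using r k by simp
    ultimately have "coeff r (p - r) k \<noteq> 0" by (intro coeff_nonzero)
    then have "gpow r (p - k - r) (\<eta> r) = 0" using * by simp
    moreover have "p - k - r + k = p - r" using r k by simp
    ultimately show False using nz gpow_add[of "p - k - r" r "\<eta> r" k] by simp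
  qed
qed

end

section \<open>Orthonormal bases and tangent spaces\<close>

text \<open>
  The Gram--Schmidt process, for a bilinear form on a subspace instead of the inner product of a type.
\<close>

lemma ex_orthonormal_span:
  fixes B :: "'v::real_vector \<Rightarrow> 'v \<Rightarrow> real"
  assumes T: "subspace T"
    and lin: "\<And>u v w a b. u \<in> T \<Longrightarrow> v \<in> T \<Longrightarrow> w \<in> T \<Longrightarrow> B (a *\<^sub>R u + b *\<^sub>R v) w = a * B u w + b * B v w"
    and sym: "\<And>u v. u \<in> T \<Longrightarrow> v \<in> T \<Longrightarrow> B u v = B v u"
    and pos: "\<And>u. u \<in> T \<Longrightarrow> u \<noteq> 0 \<Longrightarrow> B u u > 0"
    and S: "finite S" "S \<subseteq> T"
  shows "\<exists>E. finite E \<and> E \<subseteq> T \<and> span E = span S \<and> (\<forall>u\<in>E. \<forall>v\<in>E. B u v = (if u = v then 1 else 0))"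
  using S
proof (induction S rule: finite_induct)
  case (insert b S)
  then obtain E where E: "finite E" "E \<subseteq> T" "span E = span S"
    and on: "\<And>u v. u \<in> E \<Longrightarrow> v \<in> E \<Longrightarrow> B u v = (if u = v then 1 else 0)" by auto
  define s where "s = (\<Sum>e\<in>E. B b e *\<^sub>R e)"
  define w where "w = b - s"
  have bT: "b \<in> T" using insert by simp
  have sE: "s \<in> span E" unfolding s_def by (intro span_sum span_scale span_base)
  have sT: "s \<in> T" using span_minimal[OF E(2) T] sE by blast
  have wT: "w \<in> T" unfolding w_def using T bT sT by (rule subspace_diff)
  have orth: "B w f = 0" if f: "f \<in> E" for f
  proof -
    have fT: "f \<in> T" using f E by auto
    have "B s f = (\<Sum>e\<in>E. B b e * B e f)"
      unfolding s_def by (rule sum_on_subspace[OF T E(1,2), where f = "\<lambda>v. B v f"]) (rule lin[OF _ _ fT])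
    also have "\<dots> = (\<Sum>e\<in>E. if e = f then B b f else 0)"
      using on f by (intro sum.cong) auto
    also have "\<dots> = B b f" using f E by simp
    finally show ?thesis using lin[OF bT sT fT, of 1 "-1"] by (simp add: w_def)
  qed
  show ?case
  proof (cases "w = 0")
    case True
    then have "b \<in> span S" using sE E(3) by (simp add: w_def)
    then have "span E = span (insert b S)" using span_redundant[of b S] E(3) by metis
    with E(1,2) on show ?thesis by (intro exI[of _ E] conjI ballI) simp_all
  next
    case False
    define t where "t = sqrt (B w w)"
    \<comment> \<open>the square root makes \<open>e\<close> a unit vector\<close>
    define e where "e = (1 / t) *\<^sub>R w"
    have t: "t > 0" "t * t = B w w" using pos[OF wT False] by (simp_all add: t_def)
    have eT: "e \<in> T" unfolding e_def using T wT by (rule subspace_scale)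
    have ev: "B e v = B w v / t" if "v \<in> T" for v
      using lin[OF wT wT that, of "1 / t" 0] by (simp add: e_def)
    have "B e e = 1"
      unfolding ev[OF eT] sym[OF wT eT] ev[OF wT] t(2)[symmetric] using t(1) by simp
    moreover have ef: "B e f = 0" "B f e = 0" if "f \<in> E" for f
    proof -
      have f: "f \<in> T" using that E(2) by auto
      show "B e f = 0" unfolding ev[OF f] orth[OF that] by simp
      then show "B f e = 0" unfolding sym[OF f eT] .
    qed
    moreover have "e \<notin> E" using ef(1)[of e] \<open>B e e = 1\<close> by auto
    ultimately have "\<forall>u\<in>insert e E. \<forall>v\<in>insert e E. B u v = (if u = v then 1 else 0)"
      using on by auto
    moreover have "span (insert e E) = span (insert b S)"
    proof -
      have sub: "span E \<subseteq> span (insert e E)" "span E \<subseteq> span (insert b S)"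
        by (simp add: span_mono subset_insertI) (simp add: E(3) span_mono subset_insertI)
      have "b = t *\<^sub>R e + s" using t by (simp add: e_def w_def)
      moreover have "t *\<^sub>R e + s \<in> span (insert e E)"
        by (intro span_add span_scale subsetD[OF sub(1) sE] span_base insertI1)
      ultimately have b: "b \<in> span (insert e E)" by metis
      have e: "e \<in> span (insert b S)"
        unfolding e_def w_def by (intro span_scale span_diff subsetD[OF sub(2) sE] span_base insertI1)
      have "E \<subseteq> span (insert b S)" "S \<subseteq> span (insert e E)"
        using sub span_superset[of E] span_superset[of S] E(3) by blast+
      with b e show ?thesis
        unfolding span_eq by blast
    qed
    ultimately show ?thesis using E eT by (intro exI[of _ "insert e E"]) auto
  qed
qed auto

lemma smooth_manifold_chart:
  assumes M: "smooth_manifold M A" and c: "c \<in> A"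
  shows chart_open: "open (snd c ` fst c)"
    and chart_overlap_open: "d \<in> A \<Longrightarrow> open (snd c ` (fst c \<inter> fst d))"
    and inv_chart_chart: "x \<in> fst c \<Longrightarrow> inv_chart c (snd c x) = x"
proof -
  have o: "openin M (fst c)" "open (snd c ` fst c)"
    and h: "homeomorphic_map (subtopology M (fst c)) (top_of_set (snd c ` fst c)) (snd c)"
    using M c by (auto simp: smooth_manifold_def)
  show "open (snd c ` fst c)" by (rule o(2))
  have top: "topspace (subtopology M (fst c)) = fst c"
    using openin_subset[OF o(1)] by auto
  have inj: "inj_on (snd c) (fst c)"
    using homeomorphic_imp_injective_map[OF h] unfolding top .
  show "inv_chart c (snd c x) = x" if "x \<in> fst c"
    using inj that by (simp add: inv_chart_def)
  assume d: "d \<in> A"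
  then have "openin M (fst d)" using M by (auto simp: smooth_manifold_def)
  then have "openin (subtopology M (fst c)) (fst c \<inter> fst d)"
    by (metis openin_subtopology_Int2)
  then have "openin (top_of_set (snd c ` fst c)) (snd c ` (fst c \<inter> fst d))"
    using homeomorphic_imp_open_map[OF h] unfolding open_map_def by blast
  then show "open (snd c ` (fst c \<inter> fst d))"
    using o(2) openin_open_trans by blast
qed

lemma transition_chart:
  assumes M: "smooth_manifold M A" and c: "c \<in> A" and x: "x \<in> fst c"
  shows "transition c d (snd c x) = snd d x"
  using inv_chart_chart[OF M c x] by (simp add: transition_def)

lemma transition_differentiable:
  assumes M: "smooth_manifold M A" and cd: "c \<in> A" "d \<in> A" and x: "x \<in> fst c" "x \<in> fst d"
  shows "transition c d differentiable at (snd c x)"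
proof -
  have "Ck_on 1 (snd c ` (fst c \<inter> fst d)) (transition c d)"
    using M cd unfolding smooth_manifold_def smooth_on_def by blast
  then show ?thesis using x by auto
qed

lemma frechet_derivative_transition_self:
  assumes M: "smooth_manifold M A" and c: "c \<in> A" and x: "x \<in> fst c"
  shows "frechet_derivative (transition c c) (at (snd c x)) v = v"
proof -
  have "frechet_derivative (\<lambda>y. y) (at (snd c x)) = frechet_derivative (transition c c) (at (snd c x))"
    using x transition_chart[OF M c, where d = c]
    by (intro frechet_derivative_transform_within_open[OF _ chart_open[OF M c]]) auto
  then show ?thesis by (metis frechet_derivative_ident)
qed

text \<open>
  The chain rule for the cocycle identity of the transition maps, which holds near \<open>x\<close> only.
\<close>

lemma frechet_derivative_transition_compose:
  assumes M: "smooth_manifold M A" and cde: "c \<in> A" "d \<in> A" "e \<in> A"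
    and x: "x \<in> fst c" "x \<in> fst d" "x \<in> fst e"
  shows "frechet_derivative (transition d e) (at (snd d x)) (frechet_derivative (transition c d) (at (snd c x)) v)
       = frechet_derivative (transition c e) (at (snd c x)) v"
proof -
  note t = transition_chart[OF M cde(1) x(1), of d]
  have d1: "transition c d differentiable at (snd c x)"
    and d2: "transition d e differentiable at (transition c d (snd c x))"
    using transition_differentiable[OF M] cde x by (auto simp: t)
  have "frechet_derivative (transition d e \<circ> transition c d) (at (snd c x))
      = frechet_derivative (transition c e) (at (snd c x))"
  proof (rule frechet_derivative_transform_within_open)
    show "transition d e \<circ> transition c d differentiable at (snd c x)"
      by (rule differentiable_chain_at[OF d1 d2])
    show "open (snd c ` (fst c \<inter> fst d))" by (rule chart_overlap_open[OF M cde(1,2)])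
    show "snd c x \<in> snd c ` (fst c \<inter> fst d)" using x by blast
    show "(transition d e \<circ> transition c d) y = transition c e y"
      if "y \<in> snd c ` (fst c \<inter> fst d)" for y
      using that transition_chart[OF M cde(1), of _ d] transition_chart[OF M cde(1), of _ e]
        transition_chart[OF M cde(2), of _ e] by auto
  qed
  then show ?thesis
    unfolding frechet_derivative_compose[OF d1 d2] t by (metis o_apply)
qed

lemma chart_vector_linear:
  assumes M: "smooth_manifold M A" and c: "c \<in> A" and x: "x \<in> fst c"
  shows "linear (chart_vector A c x)"
proof -
  have "linear (frechet_derivative (transition c d) (at (snd c x)))" if "d \<in> A" "x \<in> fst d" for d
    using linear_frechet_derivative transition_differentiable[OF M c that(1) x that(2)] by blast
  then show ?thesis
    by (intro linearI) (auto simp: chart_vector_def fun_eq_iff scaleR_fun_def linear_add linear_scale)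
qed

text \<open>
  A tangent vector stores its coordinates in the chart \<open>c\<close>, so they can be read off at \<open>c\<close>.
\<close>

lemma chart_vector_inj:
  assumes M: "smooth_manifold M A" and c: "c \<in> A" and x: "x \<in> fst c"
  shows "inj (chart_vector A c x)"
proof (rule injI)
  fix v w assume "chart_vector A c x v = chart_vector A c x w"
  then have "chart_vector A c x v c = chart_vector A c x w c" by simp
  then show "v = w"
    using c x frechet_derivative_transition_self[OF M c x] by (simp add: chart_vector_def)
qed

lemma range_chart_vector:
  assumes M: "smooth_manifold M A" and c: "c \<in> A" and x: "x \<in> fst c"
  shows "range (chart_vector A c x) = tangent_space A x"
proof (intro equalityI subsetI)
  fix t assume "t \<in> range (chart_vector A c x)"
  then obtain v where t: "t = chart_vector A c x v" by blast
  have "t e = frechet_derivative (transition d e) (at (snd d x)) (t d)"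
    if "d \<in> A" "e \<in> A" "x \<in> fst d" "x \<in> fst e" for d e
    using that frechet_derivative_transition_compose[OF M c that(1,2) x that(3,4), of v]
    by (simp add: t chart_vector_def)
  moreover have "t d = 0" if "\<not> (d \<in> A \<and> x \<in> fst d)" for d
    unfolding t chart_vector_def if_not_P[OF that] ..
  ultimately show "t \<in> tangent_space A x"
    unfolding tangent_space_def by blast
next
  fix t assume t: "t \<in> tangent_space A x"
  have "t d = chart_vector A c x (t c) d" for d
  proof (cases "d \<in> A \<and> x \<in> fst d")
    case True
    then have "t d = frechet_derivative (transition c d) (at (snd c x)) (t c)"
      using t c x unfolding tangent_space_def by blast
    then show ?thesis using True by (simp add: chart_vector_def)
  next
    case False
    then have "t d = 0" using t unfolding tangent_space_def by blast
    then show ?thesis using False by (simp only: chart_vector_def if_False)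
  qed
  then have "t = chart_vector A c x (t c)" by (rule ext)
  then show "t \<in> range (chart_vector A c x)" by blast
qed

text \<open>
  Coordinates in a chart identify the tangent space with \<open>\<real>\<^sup>n\<close>.
\<close>

lemma tangent_space_basis:
  assumes M: "smooth_manifold M (A :: ('a, 'n::finite) chart set)" and x: "x \<in> topspace M"
  obtains B where "finite B" "independent B" "span B = tangent_space A x" "card B = CARD('n)"
proof -
  have "x \<in> (\<Union>c\<in>A. fst c)" using M x by (simp add: smooth_manifold_def)
  then obtain c where c: "c \<in> A" "x \<in> fst c" by blast
  let ?f = "chart_vector A c x"
  note lin = chart_vector_linear[OF M c] and inj = chart_vector_inj[OF M c]
  show ?thesis
  proof
    show "finite (?f ` Basis)" by simp
    show "independent (?f ` Basis)"
      by (rule linear_independent_injective_image[OF lin independent_Basis inj_on_subset[OF inj subset_UNIV]])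
    show "span (?f ` Basis) = tangent_space A x"
      unfolding linear_span_image[OF lin] span_Basis by (rule range_chart_vector[OF M c])
    show "card (?f ` Basis) = CARD('n)"
      unfolding card_image[OF inj_on_subset[OF inj subset_UNIV]] by simp
  qed
qed

lemma inner_product_tangent_space:
  assumes R: "riemannian_manifold M (A :: ('a, 'n::finite) chart set) g" and x: "x \<in> topspace M"
  shows "inner_product_subspace (g x) (tangent_space A x) CARD('n)"
proof -
  have M: "smooth_manifold M A" using R by (simp add: riemannian_manifold_def)
  have g: "g x \<in> dform_space 1 (tangent_space A x)"
    using R x by (simp add: riemannian_manifold_def double_forms_def)
  have sym: "g x [u] [v] = g x [v] [u]" if "u \<in> tangent_space A x" "v \<in> tangent_space A x" for u v
    using R x that by (simp add: riemannian_manifold_def)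
  obtain B where B: "finite B" "independent B" "span B = tangent_space A x" "card B = CARD('n)"
    using tangent_space_basis[OF M x] .
  have T: "subspace (tangent_space A x)" using B(3) by (metis subspace_span)
  have BT: "B \<subseteq> tangent_space A x" using B(3) span_superset by blast
  have "\<exists>E. finite E \<and> E \<subseteq> tangent_space A x \<and> span E = span B \<and>
      (\<forall>u\<in>E. \<forall>v\<in>E. g x [u] [v] = (if u = v then 1 else 0))"
  proof (rule ex_orthonormal_span[OF T _ sym _ B(1) BT])
    show "g x [a *\<^sub>R u + b *\<^sub>R v] [w] = a * g x [u] [w] + b * g x [v] [w]"
      if "u \<in> tangent_space A x" "v \<in> tangent_space A x" for u v w a b
      using alternating_formsD(2)[OF dform_spaceD(1)[OF g, of "[w]"], of "[u]" 0 u v a b] that by simp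
    show "0 < g x [u] [u]" if "u \<in> tangent_space A x" "u \<noteq> 0" for u
      using R x that by (simp add: riemannian_manifold_def)
  qed
  then have ex: "\<exists>E. orthonormal_basis (g x) (tangent_space A x) E"
    using B(3) by (auto simp: orthonormal_basis_def)
  have dim: "dim (tangent_space A x) = CARD('n)"
    using dim_span[of B] dim_eq_card_independent[OF B(2)] unfolding B(3,4) by simp
  show ?thesis
    by (rule inner_product_subspace.intro) (fact g, erule (1) sym, fact ex, fact dim)
qed

section \<open>Smooth functions and the equivalence on a manifold\<close>

text \<open>
  Openness is essential: the derivatives in the definition are taken at points of \<open>S\<close>, but see the
  function in a neighbourhood.
\<close>

lemma Ck_on_cong:
  assumes "open S" "\<And>x. x \<in> S \<Longrightarrow> f x = h x" "Ck_on k S f"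
  shows "Ck_on k S h"
  using assms(2,3)
proof (induction k arbitrary: f h)
  case 0
  then have "continuous_on S f" by (simp only: Ck_on.simps)
  then show ?case
    unfolding Ck_on.simps by (rule continuous_on_eq) (rule 0(1))
next
  case (Suc k)
  have f: "f differentiable at x" if "x \<in> S" for x using Suc.prems(2) that unfolding Ck_on.simps by blast
  have h: "(h has_derivative frechet_derivative f (at x)) (at x)" if "x \<in> S" for x
    by (rule has_derivative_transform_within_open[OF f[OF that, unfolded frechet_derivative_works]
          assms(1) that Suc.prems(1)])
  have "Ck_on k S (\<lambda>x. frechet_derivative h (at x) v)" for v
  proof (rule Suc.IH)
    show "frechet_derivative f (at x) v = frechet_derivative h (at x) v" if "x \<in> S" for x
      by (rule fun_cong[OF frechet_derivative_at[OF h[OF that]]])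
    show "Ck_on k S (\<lambda>x. frechet_derivative f (at x) v)" using Suc.prems(2) unfolding Ck_on.simps by blast
  qed
  moreover have "h differentiable at x" if "x \<in> S" for x
    using h[OF that] by (rule differentiableI)
  ultimately show ?case unfolding Ck_on.simps by blast
qed

lemma Ck_on_cmult:
  fixes f :: "'a::real_normed_vector \<Rightarrow> real"
  assumes S: "open S" and "Ck_on k S f"
  shows "Ck_on k S (\<lambda>x. a * f x)"
  using assms(2)
proof (induction k arbitrary: f)
  case 0
  then show ?case by (simp only: Ck_on.simps continuous_on_mult_left)
next
  case (Suc k)
  have d: "((\<lambda>x. a * f x) has_derivative (\<lambda>v. a * frechet_derivative f (at x) v)) (at x)" if "x \<in> S" for x
  proof (rule has_derivative_mult_right)
    show "(f has_derivative frechet_derivative f (at x)) (at x)"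
      using Suc.prems that unfolding Ck_on.simps frechet_derivative_works by blast
  qed
  have "Ck_on k S (\<lambda>x. frechet_derivative (\<lambda>x. a * f x) (at x) v)" for v
  proof (rule Ck_on_cong[OF S])
    show "a * frechet_derivative f (at x) v = frechet_derivative (\<lambda>x. a * f x) (at x) v" if "x \<in> S" for x
      by (rule fun_cong[OF frechet_derivative_at[OF d[OF that]]])
    show "Ck_on k S (\<lambda>x. a * frechet_derivative f (at x) v)"
      using Suc.prems unfolding Ck_on.simps by (intro Suc.IH) blast
  qed
  moreover have "(\<lambda>x. a * f x) differentiable at x" if "x \<in> S" for x
    using d[OF that] by (rule differentiableI)
  ultimately show ?case unfolding Ck_on.simps by blast
qed

text \<open>
  The factor of proportionality is a constant multiple of the component of order \<open>0\<close>, whose smoothness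
  as a double form is that of its value on empty lists.
\<close>

lemma smooth_function_order_0:
  assumes M: "smooth_manifold M A" and \<omega>: "\<omega> \<in> double_forms M A 0"
  shows "smooth_function A (\<lambda>x. a * \<omega> x [] [])"
  unfolding smooth_function_def
proof
  fix c assume c: "c \<in> A"
  have "smooth_on (snd c ` fst c) (\<lambda>y. \<omega> (inv_chart c y) [] [])"
    using \<omega> c unfolding double_forms_def by force
  then have "smooth_on (snd c ` fst c) (\<lambda>y. a * \<omega> (inv_chart c y) [] [])"
    unfolding smooth_on_def using Ck_on_cmult[OF chart_open[OF M c]] by blast
  then show "smooth_on (snd c ` fst c) ((\<lambda>x. a * \<omega> x [] []) \<circ> inv_chart c)"
    by (simp add: o_def)
qed

theorem proposition2p2:
  fixes M :: "'a topology" and A :: "('a, 'n::finite) chart set"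
    and g \<omega> :: "'a \<Rightarrow> ('a, 'n) tvec dform"
    and \<omega>c :: "nat \<Rightarrow> 'a \<Rightarrow> ('a, 'n) tvec dform"
    and p k :: nat
  assumes "riemannian_manifold M A g"
    and "p \<le> CARD('n)"
    and "\<omega> \<in> double_forms M A p"
    and "\<And>r. r \<le> p \<Longrightarrow> \<omega>c r \<in> trace_free_forms M A g r"
    and "\<And>x. x \<in> topspace M \<Longrightarrow>
           \<omega> x = (\<Sum>i\<le>p. dform_prod i (p - i) (dform_pow (g x) i) (\<omega>c (p - i) x))"
    and "1 \<le> k" and "k < p"
  shows "(\<exists>lam. smooth_function A lam \<and>
            (\<forall>x\<in>topspace M. (contraction (g x) (tangent_space A x) ^^ k) (\<omega> x)
                = lam x *\<^sub>R dform_pow (g x) (p - k)))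
         \<longleftrightarrow>
         (\<forall>r. 1 \<le> r \<and> r \<le> p - k \<longrightarrow>
            (\<forall>x\<in>topspace M. dform_prod (p - r) r (dform_pow (g x) (p - r)) (\<omega>c r x) = 0))"
    (is "?proportional \<longleftrightarrow> ?vanish")
proof
  have tf: "\<omega>c r x \<in> trace_free_space (g x) r (tangent_space A x)" if "r \<le> p" "x \<in> topspace M" for r x
    using assms(4)[OF that(1)] that(2) by (simp add: trace_free_forms_def)
  have k: "k \<le> p" using assms(7) by simp
  show ?vanish if ?proportional
  proof (intro allI impI ballI)
    fix r x assume r: "1 \<le> r \<and> r \<le> p - k" and x: "x \<in> topspace M"
    interpret inner_product_subspace "g x" "tangent_space A x" "CARD('n)"
      by (rule inner_product_tangent_space[OF assms(1) x])
    obtain lam where "(contraction (g x) (tangent_space A x) ^^ k) (\<omega> x) = lam *\<^sub>R dform_pow (g x) (p - k)"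
      using \<open>?proportional\<close> x by blast
    then show "dform_prod (p - r) r (dform_pow (g x) (p - r)) (\<omega>c r x) = 0"
      using contraction_power_eq_only_if[where \<eta> = "\<lambda>r. \<omega>c r x", OF tf[OF _ x] k assms(5)[OF x]] r by blast
  qed
  show ?proportional if ?vanish
  proof (intro exI[of _ "\<lambda>x. contraction_coeff CARD('n) 0 p k * \<omega>c 0 x [] []"] conjI ballI)
    have "\<omega>c 0 \<in> double_forms M A 0" using assms(4)[of 0] by (simp add: trace_free_forms_def)
    then show "smooth_function A (\<lambda>x. contraction_coeff CARD('n) 0 p k * \<omega>c 0 x [] [])"
      using assms(1) by (intro smooth_function_order_0) (auto simp: riemannian_manifold_def)
  next
    fix x assume x: "x \<in> topspace M"
    interpret inner_product_subspace "g x" "tangent_space A x" "CARD('n)"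
      by (rule inner_product_tangent_space[OF assms(1) x])
    show "(contraction (g x) (tangent_space A x) ^^ k) (\<omega> x)
        = (contraction_coeff CARD('n) 0 p k * \<omega>c 0 x [] []) *\<^sub>R dform_pow (g x) (p - k)"
      using contraction_power_eq_if[where \<eta> = "\<lambda>r. \<omega>c r x", OF tf[OF _ x] k assms(5)[OF x]]
        \<open>?vanish\<close> x by blast
  qed
qed

end
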